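(* Let $\mathbf{A}:\mathbb{R}^2\to\mathbb{R}^2$ be smooth, $H(q,p)=\|p-\mathbf{A}(q)\|^2$ on $T^*\mathbb{R}^2$, and $B=\partial_{q_1}A_2-\partial_{q_2}A_1$. Assume that the magnetic field $B>0$ is confining: there exist $C>0$ and $M>0$ such that $B(q)\ge C$ if $\|q\|\ge M$. Let $C_0<C$. Let $K$ be the normal form of $H$ described in the context, and let $\varphi_H^t$, $\varphi_K^t$ be the Hamiltonian flows of $H$ and $K$. Then: (1) The flow $\varphi_H^t$ is uniformly bounded for all starting points $(q,p)$ such that $B(q)\le C_0$ and $H(q,p)=\mathcal{O}(\epsilon)$, and for times of order $\mathcal{O}(1/\epsilon^N)$, where $N$ is arbitrary. (2) Up to a time of order $T_\epsilon=\mathcal{O}(|\ln\epsilon|)$, we have $$\|\varphi_H^t(q,p)-\varphi_K^t(q,p)\|=\mathcal{O}(\epsilon^\infty)$$ for all starting points $(q,p)$ such that $B(q)\le C_0$ and $H(q,p)=\mathcal{O}(\epsilon)$.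
   Context: $T^*\mathbb{R}^2$ carries the symplectic form $dp_1\wedge dq_1+dp_2\wedge dq_2$. Normal form: with $\Omega=\mathbb{R}^2$ (where $B$ does not vanish), let $\Phi$ be a symplectic diffeomorphism from an open set $\tilde\Omega\subset\mathbb{C}_{z_1}\times\mathbb{R}^2_{z_2}$ (with symplectic form $d\xi_1\wedge dx_1+d\xi_2\wedge dx_2$, $z_1=x_1+i\xi_1$, $z_2=(x_2,\xi_2)$) into $T^*\mathbb{R}^2$, sending $\{z_1=0\}$ to $\{H=0\}$, and $f:\mathbb{R}^2\times\mathbb{R}\to\mathbb{R}$ smooth, such that $H\circ\Phi=|z_1|^2f(z_2,|z_1|^2)+\mathcal{O}(|z_1|^\infty)$, such that $\varphi(q):=\Phi^{-1}(q,\mathbf{A}(q))\in\{0\}\times\mathbb{R}^2_{z_2}$ is defined for all $q\in\Omega$ and is a local diffeomorphism, and $f(\varphi(q),0)=|B(q)|$. Then $K:=\big(|z_1|^2f(z_2,|z_1|^2)\big)\circ\Phi^{-1}$. Asymptotic statements are as $\epsilon\to0^+$ and are uniform in the starting points considered: e.g. "$H(q,p)=\mathcal{O}(\epsilon)$ and times of order $\mathcal{O}(\epsilon^{-N})$" means $H(q,p)\le a\epsilon$ and $|t|\le b\epsilon^{-N}$ for fixed constants $a,b$ and all small $\epsilon$. $\mathcal{O}(\epsilon^\infty)$ means $\mathcal{O}(\epsilon^k)$ for every $k$. *)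

theory Defs
  imports "HOL-Analysis.Analysis"
begin

text \<open>
  Meant for open \<open>S\<close>. Higher derivatives are taken one direction \<open>v\<close> at a time, so that the type
  of the function stays the same; in finite dimension this is the usual \<open>C\<^sup>k\<close>.
\<close>

primrec Ck_on ::
  "nat \<Rightarrow> 'a::euclidean_space set \<Rightarrow> ('a \<Rightarrow> 'b::euclidean_space) \<Rightarrow> bool" where
  "Ck_on 0 S f \<longleftrightarrow> continuous_on S f"
| "Ck_on (Suc k) S f \<longleftrightarrow> (\<forall>x\<in>S. f differentiable (at x)) \<and>
     (\<forall>v. Ck_on k S (\<lambda>x. frechet_derivative f (at x) v))"

definition smooth_on :: "'a::euclidean_space set \<Rightarrow> ('a \<Rightarrow> 'b::euclidean_space) \<Rightarrow> bool" where
  "smooth_on S f \<longleftrightarrow> (\<forall>k. Ck_on k S f)"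

definition diffeo_on :: "'a::euclidean_space set \<Rightarrow> ('a \<Rightarrow> 'b::euclidean_space) \<Rightarrow> bool" where
  "diffeo_on S f \<longleftrightarrow> open S \<and> smooth_on S f \<and> inj_on f S \<and>
     open (f ` S) \<and> smooth_on (f ` S) (inv_into S f)"

definition local_diffeo :: "('a::euclidean_space \<Rightarrow> 'b::euclidean_space) \<Rightarrow> bool" where
  "local_diffeo f \<longleftrightarrow> (\<forall>x. \<exists>V. x \<in> V \<and> diffeo_on V f)"

text \<open>A point of the phase space is a pair \<open>(q, p)\<close> of position and momentum.\<close>

type_synonym phase = "(real^2) \<times> (real^2)"

text \<open>The form \<open>dp\<^sub>1 \<and> dq\<^sub>1 + dp\<^sub>2 \<and> dq\<^sub>2\<close>.\<close>

definition sympl :: "phase \<Rightarrow> phase \<Rightarrow> real" where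
  "sympl u v = (\<Sum>i\<in>UNIV. snd u $ i * fst v $ i - fst u $ i * snd v $ i)"

text \<open>Hamilton's equations \<open>q' = \<partial>F/\<partial>p\<close>, \<open>p' = - \<partial>F/\<partial>q\<close>.\<close>

definition ham_vf :: "(phase \<Rightarrow> real) \<Rightarrow> phase \<Rightarrow> phase" where
  "ham_vf F x =
     ((\<chi> i. frechet_derivative F (at x) (0, axis i 1)),
      (\<chi> i. - frechet_derivative F (at x) (axis i 1, 0)))"

lemma sympl_ham_vf:
  assumes "F differentiable (at x)"
  shows "sympl (ham_vf F x) v = - frechet_derivative F (at x) v"
proof -
  interpret linear "frechet_derivative F (at x)"
    using assms by (rule linear_frechet_derivative)
  have "v = (\<Sum>i\<in>UNIV. (fst v $ i) *\<^sub>R (axis i 1, 0) + (snd v $ i) *\<^sub>R (0, axis i 1))"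
    by (simp add: prod_eq_iff fst_sum snd_sum vec_eq_iff forall_2 sum_2 axis_def)
  then have "frechet_derivative F (at x) v =
      frechet_derivative F (at x)
        (\<Sum>i\<in>UNIV. (fst v $ i) *\<^sub>R (axis i 1, 0) + (snd v $ i) *\<^sub>R (0, axis i 1))"
    by simp
  also have "\<dots> = (\<Sum>i\<in>UNIV. (fst v $ i) * frechet_derivative F (at x) (axis i 1, 0)
      + (snd v $ i) * frechet_derivative F (at x) (0, axis i 1))"
    by (simp only: sum add scale real_scaleR_def)
  finally show ?thesis
    by (simp add: sympl_def ham_vf_def sum_2)
qed

text \<open>
  Integral curves of the Hamiltonian vector field of \<open>F\<close>, over the time interval between \<open>0\<close> and
  \<open>t\<close> (where \<open>t\<close> may be negative), that stay in the open set \<open>U\<close> on which \<open>F\<close> is defined.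
\<close>

definition ham_curve :: "phase set \<Rightarrow> (phase \<Rightarrow> real) \<Rightarrow> real \<Rightarrow> (real \<Rightarrow> phase) \<Rightarrow> bool" where
  "ham_curve U F t \<gamma> \<longleftrightarrow> (\<forall>s\<in>closed_segment 0 t. \<gamma> s \<in> U \<and>
     (\<gamma> has_vector_derivative ham_vf F (\<gamma> s)) (at s within closed_segment 0 t))"

text \<open>
  \<open>ham_flow U F t x\<close> is meaningful only if \<open>ham_flow_defined U F t x\<close> holds, that is, if the
  maximal integral curve in \<open>U\<close> starting at \<open>x\<close> exists up to time \<open>t\<close>.
\<close>

definition ham_flow_defined :: "phase set \<Rightarrow> (phase \<Rightarrow> real) \<Rightarrow> real \<Rightarrow> phase \<Rightarrow> bool" where
  "ham_flow_defined U F t x \<longleftrightarrow> (\<exists>\<gamma>. ham_curve U F t \<gamma> \<and> \<gamma> 0 = x)"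

definition ham_flow :: "phase set \<Rightarrow> (phase \<Rightarrow> real) \<Rightarrow> real \<Rightarrow> phase \<Rightarrow> phase" where
  "ham_flow U F t x = (THE y. \<exists>\<gamma>. ham_curve U F t \<gamma> \<and> \<gamma> 0 = x \<and> \<gamma> t = y)"

definition mag_ham :: "(real^2 \<Rightarrow> real^2) \<Rightarrow> phase \<Rightarrow> real" where
  "mag_ham A = (\<lambda>(q, p). (norm (p - A q))\<^sup>2)"

definition mag_field :: "(real^2 \<Rightarrow> real^2) \<Rightarrow> real^2 \<Rightarrow> real" where
  "mag_field A q =
     frechet_derivative A (at q) (axis 1 1) $ 2 - frechet_derivative A (at q) (axis 2 1) $ 1"

text \<open>
  Points of the model space are \<open>(z\<^sub>1, z\<^sub>2)\<close> with \<open>z\<^sub>1 = x\<^sub>1 + i \<xi>\<^sub>1\<close> and \<open>z\<^sub>2 = (x\<^sub>2, \<xi>\<^sub>2)\<close>; the form is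
  \<open>d\<xi>\<^sub>1 \<and> dx\<^sub>1 + d\<xi>\<^sub>2 \<and> dx\<^sub>2\<close>.
\<close>

type_synonym model = "complex \<times> (real^2)"

definition model_sympl :: "model \<Rightarrow> model \<Rightarrow> real" where
  "model_sympl u v =
     (Im (fst u) * Re (fst v) - Re (fst u) * Im (fst v)) +
     (snd u $ 2 * snd v $ 1 - snd u $ 1 * snd v $ 2)"

definition symplectic_diffeo :: "model set \<Rightarrow> (model \<Rightarrow> phase) \<Rightarrow> bool" where
  "symplectic_diffeo W \<Phi> \<longleftrightarrow> diffeo_on W \<Phi> \<and>
     (\<forall>z\<in>W. \<forall>u v. sympl (frechet_derivative \<Phi> (at z) u) (frechet_derivative \<Phi> (at z) v)
        = model_sympl u v)"

text \<open>\<open>g = O(|z\<^sub>1|\<^sup>\<infinity>)\<close> on \<open>W\<close>, locally uniformly.\<close>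

definition flat_remainder :: "model set \<Rightarrow> (model \<Rightarrow> real) \<Rightarrow> bool" where
  "flat_remainder W g \<longleftrightarrow>
     (\<forall>Q k. compact Q \<and> Q \<subseteq> W \<longrightarrow> (\<exists>c. \<forall>z\<in>Q. \<bar>g z\<bar> \<le> c * norm (fst z) ^ k))"

definition nf_model :: "((real^2) \<times> real \<Rightarrow> real) \<Rightarrow> model \<Rightarrow> real" where
  "nf_model f = (\<lambda>(z1, z2). (norm z1)\<^sup>2 * f (z2, (norm z1)\<^sup>2))"

definition nf_ham ::
  "model set \<Rightarrow> (model \<Rightarrow> phase) \<Rightarrow> ((real^2) \<times> real \<Rightarrow> real) \<Rightarrow> phase \<Rightarrow> real" where
  "nf_ham W \<Phi> f = nf_model f \<circ> inv_into W \<Phi>"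

text \<open>The plane \<open>{0} \<times> \<real>\<^sup>2\<close> is identified with \<open>\<real>\<^sup>2\<close>: \<open>nf_base\<close> is the second component of \<open>\<phi>\<close>.\<close>

definition nf_base ::
  "(real^2 \<Rightarrow> real^2) \<Rightarrow> model set \<Rightarrow> (model \<Rightarrow> phase) \<Rightarrow> real^2 \<Rightarrow> real^2" where
  "nf_base A W \<Phi> q = snd (inv_into W \<Phi> (q, A q))"

definition is_normal_form ::
  "(real^2 \<Rightarrow> real^2) \<Rightarrow> model set \<Rightarrow> (model \<Rightarrow> phase) \<Rightarrow> ((real^2) \<times> real \<Rightarrow> real) \<Rightarrow> bool" where
  "is_normal_form A W \<Phi> f \<longleftrightarrow>
     symplectic_diffeo W \<Phi> \<and>
     smooth_on UNIV f \<and>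
     \<Phi> ` {z \<in> W. fst z = 0} = {x. mag_ham A x = 0} \<and>
     flat_remainder W (\<lambda>z. mag_ham A (\<Phi> z) - nf_model f z) \<and>
     (\<forall>q. (q, A q) \<in> \<Phi> ` W \<and> fst (inv_into W \<Phi> (q, A q)) = 0) \<and>
     local_diffeo (nf_base A W \<Phi>) \<and>
     (\<forall>q. f (nf_base A W \<Phi> q, 0) = \<bar>mag_field A q\<bar>)"

end

theory Submission
  imports Defs
begin

text \<open>
  The energy surface \<open>H = 0\<close> is the graph \<open>p = A q\<close>, and near it the motion has a fast part (rotation
  of \<open>z\<^sub>1\<close>) and a slow part (drift of \<open>z\<^sub>2\<close>). In the coordinates \<open>\<Psi> = \<Phi>\<inverse>\<close> the Hamiltonian \<open>K\<close> is
  \<open>I g\<close>, where \<open>I = |z\<^sub>1|\<^sup>2\<close> and \<open>g = f(z\<^sub>2, I)\<close>. Since \<open>I\<close> generates the rotations of \<open>z\<^sub>1\<close>, it Poisson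
  commutes with \<open>g\<close>, so both \<open>I\<close> and \<open>g\<close> are exact first integrals of \<open>K\<close> (\<open>K_conserves\<close>). The
  vector fields of \<open>H\<close> and \<open>K\<close> differ by \<open>O(|z\<^sub>1|\<^sup>\<infinity>)\<close> on compact sets: the difference \<open>H - K\<close> is flat
  by hypothesis, and a flat function of class \<open>C\<^sup>2\<close> has a flat gradient
  (\<open>flat_function_has_flat_derivative\<close>). Hence \<open>I\<close> and \<open>g\<close> are adiabatic invariants of \<open>H\<close>: their
  speed along \<open>H\<close> is \<open>O(|z\<^sub>1|\<^sup>\<infinity>)\<close>.

  Work in a compact tube \<open>|q| \<le> M\<close>, \<open>|p - A q| \<le> \<rho>\<close> inside the image of \<open>\<Phi>\<close>. There \<open>I\<close> and \<open>H\<close> are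
  comparable, and \<open>g\<close> differs from the magnetic field \<open>B\<close> by \<open>O(\<surd>H)\<close>, because \<open>g = B\<close> on the graph
  (\<open>tube_estimates\<close>). Start with \<open>B \<le> C0\<close> and \<open>H = O(\<epsilon>)\<close>, so that \<open>I = O(\<epsilon>)\<close>. As long as the curve
  stays in the tube with \<open>I = O(\<epsilon>)\<close>, the quantities \<open>I\<close> and \<open>g\<close> change over a time \<open>O(\<epsilon>\<^sup>-\<^sup>N)\<close> by an
  arbitrarily high power of \<open>\<epsilon>\<close>. So \<open>B \<le> C0 + O(\<surd>\<epsilon>) < C\<close> along the curve, whereas \<open>B \<ge> C\<close> where the
  tube could be left through \<open>|q| = M\<close>, and \<open>|p - A q| = \<surd>H = O(\<surd>\<epsilon>)\<close> remains below \<open>\<rho>\<close>. A bootstrap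
  in time turns this into confinement, for the flows of \<open>H\<close> and \<open>K\<close> alike (\<open>confinement\<close>). This is
  the first claim, and it also supplies the compact set needed for the second one.

  For the second claim, both curves stay where the fields differ by \<open>O(\<epsilon>\<^sup>m)\<close> for any \<open>m\<close>, and the
  field of \<open>K\<close> has a Lipschitz constant \<open>L\<close> there. Gronwall's inequality loses a factor
  \<open>exp (O(L) |ln \<epsilon>|)\<close>, a fixed negative power of \<open>\<epsilon>\<close>, which a large \<open>m\<close> absorbs
  (\<open>flows_comparison\<close>).

  Existence of the curves comes from the same a priori bound: a locally Lipschitz field is extended
  from the compact set to a globally Lipschitz one, whose curves exist for all times, and the bound
  shows that such a curve never reaches the region where the field was changed
  (\<open>trapped_integral_curve_exists\<close>).
\<close>

section \<open>Calculus of \<open>C\<^sup>k\<close> functions\<close>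

lemma Ck_on_Suc_imp_Ck_on: "Ck_on (Suc k) S f \<Longrightarrow> Ck_on k S f"
proof (induction k arbitrary: f)
  case 0
  then show ?case
    by (auto intro!: continuous_at_imp_continuous_on differentiable_imp_continuous_within)
next
  case (Suc k)
  then show ?case by auto
qed

lemma Ck_on_imp_continuous_on: "Ck_on k S f \<Longrightarrow> continuous_on S f"
proof (induction k)
  case (Suc k)
  then show ?case using Ck_on_Suc_imp_Ck_on by blast
qed simp

lemma Ck_on_cong:
  assumes "open S" "\<And>x. x \<in> S \<Longrightarrow> f x = g x" "Ck_on k S f"
  shows "Ck_on k S g"
  using assms(2,3)
proof (induction k arbitrary: f g)
  case 0
  then show ?case by (auto cong: continuous_on_cong)
next
  case (Suc k)
  have "(g has_derivative frechet_derivative f (at x)) (at x)" if x: "x \<in> S" for x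
  proof -
    have "(f has_derivative frechet_derivative f (at x)) (at x)"
      using Suc.prems x by (simp add: frechet_derivative_works)
    then show ?thesis
      using has_derivative_transform_within_open[OF _ \<open>open S\<close> x] Suc.prems(1) by blast
  qed
  then have "g differentiable (at x) \<and> frechet_derivative f (at x) = frechet_derivative g (at x)"
    if "x \<in> S" for x
    using that frechet_derivative_at differentiable_def by blast
  then show ?case
    using Suc.prems
      Suc.IH[of "\<lambda>x. frechet_derivative f (at x) v" "\<lambda>x. frechet_derivative g (at x) v" for v]
    by auto
qed

lemma Ck_on_SucI:
  assumes "open S" "\<And>x. x \<in> S \<Longrightarrow> (f has_derivative f' x) (at x)"
    and "\<And>v. Ck_on k S (\<lambda>x. f' x v)"
  shows "Ck_on (Suc k) S f"
proof -
  have "f' x = frechet_derivative f (at x)" if "x \<in> S" for x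
    using assms(2)[OF that] frechet_derivative_at by metis
  then show ?thesis
    using assms(2,3) Ck_on_cong[OF assms(1), of "\<lambda>x. f' x v" "\<lambda>x. frechet_derivative f (at x) v" for v]
    by (auto simp: differentiable_def)
qed

lemma Ck_on_has_derivative:
  "Ck_on (Suc k) S f \<Longrightarrow> x \<in> S \<Longrightarrow> (f has_derivative frechet_derivative f (at x)) (at x)"
  by (simp add: frechet_derivative_works)

lemma Ck_on_frechet_derivative:
  "Ck_on (Suc k) S f \<Longrightarrow> Ck_on k S (\<lambda>x. frechet_derivative f (at x) v)"
  by simp

lemma Ck_on_const: "open S \<Longrightarrow> Ck_on k S (\<lambda>x. c)"
proof (induction k arbitrary: c)
  case (Suc k)
  show ?case
    by (rule Ck_on_SucI[where f' = "\<lambda>x v. 0"]) (use Suc in auto)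
qed simp

lemma Ck_on_bounded_linear:
  assumes "bounded_linear h" "open S" shows "Ck_on k S h"
proof (cases k)
  case 0
  then show ?thesis using assms(1) linear_continuous_on by auto
next
  case (Suc m)
  then show ?thesis
    using Ck_on_SucI[where f' = "\<lambda>x. h" and f = h] assms Ck_on_const
      bounded_linear_imp_has_derivative by blast
qed

lemma Ck_on_add:
  assumes "open S" "Ck_on k S f" "Ck_on k S g" shows "Ck_on k S (\<lambda>x. f x + g x)"
  using assms(2,3)
proof (induction k arbitrary: f g)
  case 0
  then show ?case by (auto intro: continuous_intros)
next
  case (Suc k)
  show ?case
    by (rule Ck_on_SucI[OF assms(1) has_derivative_add])
      (use Suc.prems \<open>open S\<close> in \<open>auto intro: Ck_on_has_derivative Suc.IH\<close>)
qed

lemma Ck_on_sum: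
  assumes "open S" "finite I" "\<And>i. i \<in> I \<Longrightarrow> Ck_on k S (f i)"
  shows "Ck_on k S (\<lambda>x. \<Sum>i\<in>I. f i x)"
  using assms(2,3) by (induction I) (auto simp: Ck_on_const Ck_on_add \<open>open S\<close>)

lemma Ck_on_bilinear:
  assumes "bounded_bilinear mul" and S: "open S" and "Ck_on k S f" "Ck_on k S g"
  shows "Ck_on k S (\<lambda>x. mul (f x) (g x))"
  using assms(3,4)
proof (induction k arbitrary: f g)
  case 0
  then show ?case using bounded_bilinear.continuous_on[OF assms(1)] by auto
next
  case (Suc k)
  show ?case
  proof (rule Ck_on_SucI[OF S bounded_bilinear.FDERIV[OF assms(1)]])
    show "Ck_on k S (\<lambda>x. mul (f x) (frechet_derivative g (at x) v)
        + mul (frechet_derivative f (at x) v) (g x))" for v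
      by (intro Ck_on_add[OF S] Suc.IH) (use Suc.prems Ck_on_Suc_imp_Ck_on in auto)
  qed (use Suc.prems S in \<open>auto intro: Ck_on_has_derivative\<close>)
qed

text \<open>
  Expanding \<open>Dg(x) v\<close> in the basis writes the chain rule as a finite sum of products of real functions
  with partial derivatives of \<open>f\<close> composed with \<open>g\<close>. Each factor has one derivative less, so the
  induction hypothesis, the product rule and the sum rule apply.
\<close>

lemma Ck_on_compose:
  assumes "open S" "open U" "g ` S \<subseteq> U" "Ck_on k U f" "Ck_on k S g"
  shows "Ck_on k S (\<lambda>x. f (g x))"
  using assms(4,5,3)
proof (induction k arbitrary: f)
  case 0
  then show ?case by (auto intro: continuous_on_compose2)
next
  case (Suc k)
  have gS: "Ck_on k S g" using Suc.prems Ck_on_Suc_imp_Ck_on by blast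
  let ?D = "\<lambda>x v. \<Sum>b\<in>Basis. (frechet_derivative g (at x) v \<bullet> b) *\<^sub>R frechet_derivative f (at (g x)) b"
  show ?case
  proof (rule Ck_on_SucI[where f' = ?D])
    fix x assume x: "x \<in> S"
    have df: "(f has_derivative frechet_derivative f (at (g x))) (at (g x))"
      using Suc.prems x by (intro Ck_on_has_derivative[of k U]) auto
    have dg: "(g has_derivative frechet_derivative g (at x)) (at x)"
      using Suc.prems x by (intro Ck_on_has_derivative[of k S]) auto
    have lin: "linear (frechet_derivative f (at (g x)))"
      using df has_derivative_linear by blast
    have "frechet_derivative f (at (g x)) (frechet_derivative g (at x) v) = ?D x v" for v
    proof -
      have "frechet_derivative f (at (g x)) (frechet_derivative g (at x) v) =
        frechet_derivative f (at (g x)) (\<Sum>b\<in>Basis. (frechet_derivative g (at x) v \<bullet> b) *\<^sub>R b)"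
        by (simp add: euclidean_representation)
      also have "\<dots> = ?D x v"
        by (simp only: linear_sum[OF lin] linear_scale[OF lin])
      finally show ?thesis .
    qed
    then have "frechet_derivative f (at (g x)) \<circ> frechet_derivative g (at x) = ?D x"
      by auto
    then show "((\<lambda>x. f (g x)) has_derivative ?D x) (at x)"
      using diff_chain_at[OF dg df] by (simp add: o_def)
  next
    fix v
    have "Ck_on k S (\<lambda>x. frechet_derivative f (at (g x)) b)" for b
      using Suc.IH[of "\<lambda>y. frechet_derivative f (at y) b"] Suc.prems gS by auto
    moreover have "Ck_on k S (\<lambda>x. frechet_derivative g (at x) v \<bullet> b)" for b
      by (intro Ck_on_bilinear[OF bounded_bilinear_inner assms(1)] Ck_on_frechet_derivative
          Suc.prems Ck_on_const[OF assms(1)])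
    ultimately show "Ck_on k S (\<lambda>x. ?D x v)"
      by (intro Ck_on_sum[OF assms(1)] Ck_on_bilinear[OF bounded_bilinear_scaleR assms(1)]) auto
  qed (use assms in auto)
qed

lemma Ck_on_linear_compose:
  assumes "bounded_linear h" "open S" "Ck_on k S f" shows "Ck_on k S (\<lambda>x. h (f x))"
  using Ck_on_compose[OF assms(2) open_UNIV _ Ck_on_bounded_linear[OF assms(1) open_UNIV] assms(3)]
  by auto

lemma Ck_on_diff:
  assumes "open S" "Ck_on k S f" "Ck_on k S g" shows "Ck_on k S (\<lambda>x. f x - g x)"
  using Ck_on_add[OF assms(1,2) Ck_on_linear_compose[OF _ assms(1,3), of uminus]]
  by (simp add: bounded_linear_minus bounded_linear_ident)

lemma Ck_on_Pair:
  assumes "open S" "Ck_on k S f" "Ck_on k S g" shows "Ck_on k S (\<lambda>x. (f x, g x))"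
proof -
  have "Ck_on k S (\<lambda>x. (f x, 0) + (0, g x))"
    by (intro Ck_on_add[OF assms(1)] Ck_on_linear_compose[where h = "\<lambda>y. (y, 0)"]
       Ck_on_linear_compose[where h = "\<lambda>y. (0, y)"] assms
       bounded_linear_Pair bounded_linear_ident bounded_linear_zero)
  then show ?thesis by simp
qed

lemma Ck_on_subset: "Ck_on k S f \<Longrightarrow> T \<subseteq> S \<Longrightarrow> Ck_on k T f"
proof (induction k arbitrary: f)
  case 0
  then show ?case using continuous_on_subset by auto
next
  case (Suc k)
  then show ?case by auto
qed

section \<open>Lipschitz bounds on compact sets\<close>

lemma C1_derivative_bounded_on_compact:
  fixes F :: "'a::euclidean_space \<Rightarrow> 'b::euclidean_space"
  assumes C1: "Ck_on (Suc 0) U F" and Q: "compact Q" "Q \<subseteq> U"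
  shows "\<exists>m\<ge>0. \<forall>x\<in>Q. \<forall>v. norm (frechet_derivative F (at x) v) \<le> m * norm v"
proof -
  let ?D = "\<lambda>y b. frechet_derivative F (at y) b"
  have "\<exists>m. \<forall>y\<in>Q. norm (?D y b) \<le> m" for b
  proof -
    have "continuous_on Q (\<lambda>y. ?D y b)"
      using Ck_on_frechet_derivative[OF C1, of b] Q by (auto elim: continuous_on_subset)
    then have "bounded ((\<lambda>y. ?D y b) ` Q)"
      by (intro compact_imp_bounded compact_continuous_image Q)
    then show ?thesis by (auto simp: bounded_iff)
  qed
  then obtain m where m: "\<And>b y. y \<in> Q \<Longrightarrow> norm (?D y b) \<le> m b" by metis
  let ?L = "\<Sum>b\<in>Basis. \<bar>m b\<bar>"
  have "norm (?D w v) \<le> ?L * norm v" if w: "w \<in> Q" for w v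
  proof -
    have lin: "linear (?D w)"
      using C1 Q w Ck_on_has_derivative has_derivative_linear by blast
    have "norm (?D w v) = norm (?D w (\<Sum>b\<in>Basis. (v \<bullet> b) *\<^sub>R b))"
      by (simp add: euclidean_representation)
    also have "\<dots> = norm (\<Sum>b\<in>Basis. (v \<bullet> b) *\<^sub>R ?D w b)"
      by (simp only: linear_sum[OF lin] linear_scale[OF lin])
    also have "\<dots> \<le> (\<Sum>b\<in>Basis. norm v * \<bar>m b\<bar>)"
    proof (rule sum_norm_le)
      fix b :: 'a assume "b \<in> Basis"
      then show "norm ((v \<bullet> b) *\<^sub>R ?D w b) \<le> norm v * \<bar>m b\<bar>"
        using m[OF w, of b] Basis_le_norm[of b v] by (auto intro!: mult_mono)
    qed
    finally show ?thesis by (simp add: sum_distrib_left mult.commute)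
  qed
  then show ?thesis by (intro exI[of _ ?L]) (auto intro: sum_nonneg)
qed

text \<open>
  For open \<open>U\<close> in a Euclidean space this is local Lipschitz continuity. Stated through compact sets
  it hands over one constant for a whole region of motion, convex or not.
\<close>

definition lipschitz_on_compacts :: "'a::metric_space set \<Rightarrow> ('a \<Rightarrow> 'b::metric_space) \<Rightarrow> bool" where
  "lipschitz_on_compacts U F \<longleftrightarrow> (\<forall>Q. compact Q \<and> Q \<subseteq> U \<longrightarrow> (\<exists>L. L-lipschitz_on Q F))"

lemma lipschitz_on_compactsE:
  assumes "lipschitz_on_compacts U F" "compact Q" "Q \<subseteq> U"
  obtains L where "L-lipschitz_on Q F"
  using assms unfolding lipschitz_on_compacts_def by blast

lemma lipschitz_on_compacts_subset:
  "lipschitz_on_compacts U F \<Longrightarrow> V \<subseteq> U \<Longrightarrow> lipschitz_on_compacts V F"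
  unfolding lipschitz_on_compacts_def by blast

lemma lipschitz_on_compacts_scaleR:
  fixes X :: "'a::metric_space \<Rightarrow> 'b::real_normed_vector"
  assumes "lipschitz_on_compacts S X" shows "lipschitz_on_compacts S (\<lambda>x. \<sigma> *\<^sub>R X x)"
  unfolding lipschitz_on_compacts_def
proof (intro allI impI, elim conjE)
  fix Q assume "compact Q" "Q \<subseteq> S"
  with assms obtain L where "L-lipschitz_on Q X" by (rule lipschitz_on_compactsE)
  then have "(\<bar>\<sigma>\<bar> * L)-lipschitz_on Q (\<lambda>x. \<sigma> *\<^sub>R X x)" by (rule lipschitz_on_cmult)
  then show "\<exists>L. L-lipschitz_on Q (\<lambda>x. \<sigma> *\<^sub>R X x)" by blast
qed

text \<open>
  The mean value inequality needs convexity, so it is applied in small closed balls; compactness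
  passes from the local constants to a constant for all of \<open>Q\<close>.
\<close>

lemma C1_imp_lipschitz_on_compacts:
  fixes F :: "'a::euclidean_space \<Rightarrow> 'b::euclidean_space"
  assumes C1: "Ck_on (Suc 0) U F" and U: "open U"
  shows "lipschitz_on_compacts U F"
  unfolding lipschitz_on_compacts_def
proof (intro allI impI, elim conjE)
  fix Q assume Q: "compact Q" "Q \<subseteq> U"
  have "local_lipschitz {0::real} U (\<lambda>_. F)"
  proof (rule local_lipschitzI)
    fix t :: real and x assume "x \<in> U"
    then obtain r where r: "r > 0" "cball x r \<subseteq> U"
      using U open_contains_cball by blast
    obtain m where m: "m \<ge> 0"
        "\<And>y v. y \<in> cball x r \<Longrightarrow> norm (frechet_derivative F (at y) v) \<le> m * norm v"
      using C1_derivative_bounded_on_compact[OF C1 compact_cball r(2)] by blast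
    have "m-lipschitz_on (cball x r) F"
    proof (rule lipschitz_onI)
      fix y z assume yz: "y \<in> cball x r" "z \<in> cball x r"
      have "norm (F y - F z) \<le> m * norm (y - z)"
      proof (rule differentiable_bound[where f' = "\<lambda>y. frechet_derivative F (at y)", OF convex_cball])
        fix w assume w: "w \<in> cball x r"
        then show "(F has_derivative frechet_derivative F (at w)) (at w within cball x r)"
          using r by (auto intro: has_derivative_at_withinI[OF Ck_on_has_derivative[OF C1]])
        show "onorm (frechet_derivative F (at w)) \<le> m"
          using m w by (intro onorm_bound)
      qed (use yz in auto)
      then show "dist (F y) (F z) \<le> m * dist y z" by (simp add: dist_norm)
    qed (rule m(1))
    then show "\<exists>u>0. \<exists>L. \<forall>t\<in>cball t u \<inter> {0::real}. L-lipschitz_on (cball x u \<inter> U) F"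
      using r lipschitz_on_subset by (metis Int_lower1)
  qed
  then have "local_lipschitz {0::real} Q (\<lambda>_. F)"
    using local_lipschitz_subset Q(2) by blast
  then show "\<exists>L. L-lipschitz_on Q F"
    using local_lipschitz_compact_implies_lipschitz[where X = Q and T = "{0::real}" and f = "\<lambda>_. F"] Q(1) by auto
qed

section \<open>Regularity of Hamiltonian vector fields\<close>

lemma ham_vf_eq_sum:
  "ham_vf F x = (\<Sum>i\<in>UNIV. frechet_derivative F (at x) (0, axis i 1) *\<^sub>R (axis i 1, 0)
     - frechet_derivative F (at x) (axis i 1, 0) *\<^sub>R (0, axis i 1))"
  by (simp add: ham_vf_def prod_eq_iff vec_eq_iff forall_2 sum_2 axis_def)

lemma Ck_on_ham_vf:
  assumes "open S" "Ck_on (Suc k) S F" shows "Ck_on k S (ham_vf F)"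
proof -
  have *: "Ck_on k S (\<lambda>x. frechet_derivative F (at x) v *\<^sub>R w)" for v and w :: phase
    by (intro Ck_on_linear_compose[where h = "\<lambda>r. r *\<^sub>R w"] Ck_on_frechet_derivative assms
        bounded_linear_scaleR_left)
  then show ?thesis
    unfolding ham_vf_eq_sum by (intro Ck_on_sum Ck_on_diff * assms(1) finite)
qed

section \<open>Integral curves of locally Lipschitz vector fields\<close>

definition integral_curve :: "('a \<Rightarrow> 'a) \<Rightarrow> 'a::euclidean_space set \<Rightarrow> real \<Rightarrow> (real \<Rightarrow> 'a) \<Rightarrow> bool" where
  "integral_curve X U T \<gamma> \<longleftrightarrow>
     (\<forall>s\<in>{0..T}. \<gamma> s \<in> U \<and> (\<gamma> has_vector_derivative X (\<gamma> s)) (at s within {0..T}))"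

lemma integral_curve_restrict:
  assumes "integral_curve X U T \<gamma>" "s \<le> T" shows "integral_curve X U s \<gamma>"
  unfolding integral_curve_def
proof (intro ballI conjI)
  fix r assume "r \<in> {0..s}"
  then have r: "r \<in> {0..T}" using assms(2) by auto
  then show "\<gamma> r \<in> U" using assms(1) by (simp add: integral_curve_def)
  have "(\<gamma> has_vector_derivative X (\<gamma> r)) (at r within {0..T})"
    using assms(1) r by (simp add: integral_curve_def)
  then show "(\<gamma> has_vector_derivative X (\<gamma> r)) (at r within {0..s})"
    by (rule has_vector_derivative_within_subset) (use assms(2) in auto)
qed

lemma integral_curve_mono: "integral_curve X U T \<gamma> \<Longrightarrow> U \<subseteq> V \<Longrightarrow> integral_curve X V T \<gamma>"
  unfolding integral_curve_def by auto

lemma integral_curve_continuous_on: "integral_curve X U T \<gamma> \<Longrightarrow> continuous_on {0..T} \<gamma>"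
  unfolding integral_curve_def continuous_on_eq_continuous_within
  using has_vector_derivative_continuous by blast

text \<open>
  With \<open>m = 2 L + 1\<close>, the function \<open>|u - v|\<^sup>2 exp (- m s) - \<delta>\<^sup>2 s\<close> is nonincreasing: the
  Cauchy--Schwarz inequality and \<open>2 \<delta> |u - v| \<le> |u - v|\<^sup>2 + \<delta>\<^sup>2\<close> bound the derivative of \<open>|u - v|\<^sup>2\<close> by
  \<open>m |u - v|\<^sup>2 + \<delta>\<^sup>2\<close>. The squared norm is used because the norm is not differentiable where the
  curves meet.
\<close>

lemma gronwall_comparison:
  fixes u v :: "real \<Rightarrow> 'a::euclidean_space"
  assumes T: "0 \<le> T"
    and u: "\<And>s. s \<in> {0..T} \<Longrightarrow> (u has_vector_derivative u' s) (at s within {0..T})"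
    and v: "\<And>s. s \<in> {0..T} \<Longrightarrow> (v has_vector_derivative v' s) (at s within {0..T})"
    and diff: "\<And>s. s \<in> {0..T} \<Longrightarrow> norm (u' s - v' s) \<le> L * norm (u s - v s) + \<delta>"
    and L: "0 \<le> L"
  shows "(norm (u T - v T))\<^sup>2 \<le> ((norm (u 0 - v 0))\<^sup>2 + \<delta>\<^sup>2 * T) * exp ((2 * L + 1) * T)"
proof -
  define m where "m = 2 * L + 1"
  define w where "w s = (u s - v s) \<bullet> (u s - v s)" for s
  define \<psi> where "\<psi> s = w s * exp (- (m * s)) - \<delta>\<^sup>2 * s" for s
  have "continuous_on {0..T} u" "continuous_on {0..T} v"
    unfolding continuous_on_eq_continuous_within
    by (auto intro: has_vector_derivative_continuous[OF u] has_vector_derivative_continuous[OF v])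
  then have cont: "continuous_on {0..T} \<psi>"
    unfolding \<psi>_def w_def by (intro continuous_intros)
  have "\<psi> T \<le> \<psi> 0"
  proof (rule DERIV_nonpos_imp_decreasing_open[OF T _ cont])
    fix s assume s: "0 < s" "s < T"
    let ?e = "u s - v s" and ?e' = "u' s - v' s"
    have "(u has_vector_derivative u' s) (at s)" "(v has_vector_derivative v' s) (at s)"
      using u[of s] v[of s] s by (auto simp: at_within_Icc_at)
    then have de: "((\<lambda>s. u s - v s) has_vector_derivative ?e') (at s)"
      by (rule has_vector_derivative_diff)
    have "(w has_real_derivative 2 * (?e \<bullet> ?e')) (at s)"
      unfolding w_def has_real_derivative_iff_has_vector_derivative
      using bounded_bilinear.has_vector_derivative[OF bounded_bilinear_inner de de]
      by (simp add: inner_commute)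
    then have d: "(\<psi> has_real_derivative
        (2 * (?e \<bullet> ?e')) * exp (- (m * s)) + w s * (exp (- (m * s)) * (- m)) - \<delta>\<^sup>2) (at s)"
      unfolding \<psi>_def by (auto intro!: derivative_eq_intros)
    have "?e \<bullet> ?e' \<le> norm ?e * norm ?e'" by (rule norm_cauchy_schwarz)
    also have "\<dots> \<le> norm ?e * (L * norm ?e + \<delta>)"
      using diff[of s] s by (intro mult_left_mono) auto
    also have "2 * \<dots> \<le> m * (norm ?e)\<^sup>2 + \<delta>\<^sup>2"
      using sum_squares_bound[of "norm ?e" \<delta>]
      by (simp add: m_def algebra_simps power2_eq_square)
    finally have 1: "2 * (?e \<bullet> ?e') - m * w s \<le> \<delta>\<^sup>2"
      by (simp add: w_def power2_norm_eq_inner)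
    have "(2 * (?e \<bullet> ?e') - m * w s) * exp (- (m * s)) \<le> \<delta>\<^sup>2 * exp (- (m * s))"
      using 1 by (rule mult_right_mono) simp
    also have "\<dots> \<le> \<delta>\<^sup>2 * 1"
      using s L by (intro mult_left_mono) (auto simp: m_def)
    finally have "(2 * (?e \<bullet> ?e')) * exp (- (m * s)) + w s * (exp (- (m * s)) * (- m)) - \<delta>\<^sup>2 \<le> 0"
      by (simp add: algebra_simps)
    with d show "\<exists>y. (\<psi> has_real_derivative y) (at s) \<and> y \<le> 0" by blast
  qed
  then have "w T * exp (- (m * T)) \<le> w 0 + \<delta>\<^sup>2 * T" by (simp add: \<psi>_def)
  then have "w T * exp (- (m * T)) * exp (m * T) \<le> (w 0 + \<delta>\<^sup>2 * T) * exp (m * T)"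
    by (rule mult_right_mono) simp
  then show ?thesis
    by (simp add: w_def m_def power2_norm_eq_inner mult.assoc flip: exp_add)
qed

lemma integral_curve_unique:
  assumes X: "lipschitz_on_compacts U X" and T: "0 \<le> T"
    and \<gamma>: "integral_curve X U T \<gamma>" and \<eta>: "integral_curve X U T \<eta>" and "\<gamma> 0 = \<eta> 0"
  shows "\<gamma> T = \<eta> T"
proof -
  let ?Q = "\<gamma> ` {0..T} \<union> \<eta> ` {0..T}"
  have "compact ?Q"
    by (intro compact_Un compact_continuous_image integral_curve_continuous_on[OF \<gamma>]
        integral_curve_continuous_on[OF \<eta>] compact_Icc)
  moreover have "?Q \<subseteq> U" using \<gamma> \<eta> by (auto simp: integral_curve_def)
  ultimately obtain L where L: "L-lipschitz_on ?Q X"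
    using X unfolding lipschitz_on_compacts_def by blast
  have "(norm (\<gamma> T - \<eta> T))\<^sup>2 \<le> ((norm (\<gamma> 0 - \<eta> 0))\<^sup>2 + 0\<^sup>2 * T) * exp ((2 * L + 1) * T)"
    using \<gamma> \<eta> lipschitz_on_nonneg[OF L] lipschitz_on_normD[OF L]
    by (intro gronwall_comparison[where u' = "\<lambda>s. X (\<gamma> s)" and v' = "\<lambda>s. X (\<eta> s)"] T)
      (auto simp: integral_curve_def)
  then show ?thesis using \<open>\<gamma> 0 = \<eta> 0\<close> by simp
qed

lemma integral_curve_increment_bound:
  fixes F :: "'a::euclidean_space \<Rightarrow> real"
  assumes \<gamma>: "integral_curve X D T \<gamma>" and T: "0 \<le> T"
    and F: "\<And>x. x \<in> D \<Longrightarrow> F differentiable (at x)"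
    and bound: "\<And>x. x \<in> D \<Longrightarrow> \<bar>frechet_derivative F (at x) (X x)\<bar> \<le> \<delta>"
  shows "\<bar>F (\<gamma> T) - F (\<gamma> 0)\<bar> \<le> \<delta> * T"
proof -
  have "norm (F (\<gamma> T) - F (\<gamma> 0)) \<le> \<delta> * norm (T - 0)"
  proof (rule field_differentiable_bound[OF convex_real_interval(5)[of 0 T],
        where f = "\<lambda>s. F (\<gamma> s)" and f' = "\<lambda>s. frechet_derivative F (at (\<gamma> s)) (X (\<gamma> s))"])
    fix s assume s: "s \<in> {0..T}"
    then have "\<gamma> s \<in> D" "(\<gamma> has_vector_derivative X (\<gamma> s)) (at s within {0..T})"
      using \<gamma> by (auto simp: integral_curve_def)
    moreover from this have "(F has_derivative frechet_derivative F (at (\<gamma> s))) (at (\<gamma> s) within \<gamma> ` {0..T})"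
      using F frechet_derivative_works has_derivative_at_withinI by blast
    ultimately show "((\<lambda>s. F (\<gamma> s)) has_real_derivative frechet_derivative F (at (\<gamma> s)) (X (\<gamma> s))) (at s within {0..T})"
      using vector_derivative_diff_chain_within
      by (fastforce simp: o_def has_real_derivative_iff_has_vector_derivative)
    show "norm (frechet_derivative F (at (\<gamma> s)) (X (\<gamma> s))) \<le> \<delta>"
      using bound \<open>\<gamma> s \<in> D\<close> by simp
  qed (use T in auto)
  then show ?thesis using T by simp
qed

text \<open>
  Picard iteration on the whole interval at once. Writing \<open>\<gamma>(s) = exp (m s) \<eta>(s)\<close>, which amounts to
  Bielecki's weighted supremum norm, makes the integral operator a contraction with factor \<open>L / m < 1\<close>
  whatever the length of the interval, so that no short solutions have to be glued together.
\<close>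

lemma global_integral_curve_exists:
  fixes X :: "'a::euclidean_space \<Rightarrow> 'a"
  assumes X: "L-lipschitz_on UNIV X" and T: "0 \<le> T"
  shows "\<exists>\<gamma>. \<gamma> 0 = x0 \<and> integral_curve X UNIV T \<gamma>"
proof -
  define m where "m = L + 1"
  have L: "0 \<le> L" and m: "0 < m" "L < m" using lipschitz_on_nonneg[OF X] by (auto simp: m_def)
  define c where "c t = max 0 (min T t)" for t
  have c: "c t \<in> {0..T}" "0 \<le> c t" for t using T by (auto simp: c_def)
  define h where "h \<eta> s = X (exp (m * s) *\<^sub>R apply_bcontfun \<eta> s)" for \<eta> :: "real \<Rightarrow>\<^sub>C 'a" and s
  define P where "P \<eta> t = exp (- (m * c t)) *\<^sub>R (x0 + integral {0..c t} (h \<eta>))" for \<eta> t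
  have Xc: "continuous_on S X" for S
    using lipschitz_on_continuous_on[OF X] continuous_on_subset by blast
  have h: "continuous_on S (h \<eta>)" for S \<eta>
    unfolding h_def by (intro continuous_on_compose2[OF Xc[of UNIV]] continuous_intros) auto
  have hi: "h \<eta> integrable_on {0..t}" for \<eta> t
    using h by (rule integrable_continuous_real)
  have Pbc: "P \<eta> \<in> bcontfun" for \<eta>
  proof -
    define p where "p t = exp (- (m * t)) *\<^sub>R (x0 + integral {0..t} (h \<eta>))" for t
    have pc: "continuous_on {0..T} p"
      unfolding p_def by (intro continuous_intros indefinite_integral_continuous_1 hi)
    have Pp: "P \<eta> = (\<lambda>t. p (c t))" by (auto simp: P_def p_def)
    have "continuous_on UNIV (P \<eta>)"
      unfolding Pp by (rule continuous_on_compose2[OF pc]) (use c in \<open>auto simp: c_def intro!: continuous_intros\<close>)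
    moreover have "bounded (range (P \<eta>))"
      using compact_imp_bounded[OF compact_continuous_image[OF pc compact_Icc]]
      by (rule bounded_subset) (use c in \<open>auto simp: Pp\<close>)
    ultimately show ?thesis by (simp add: bcontfun_def)
  qed
  define F where "F \<eta> = Bcontfun (P \<eta>)" for \<eta>
  have F: "apply_bcontfun (F \<eta>) = P \<eta>" for \<eta>
    unfolding F_def by (rule Bcontfun_inverse[OF Pbc])
  have "dist (F \<eta>) (F \<theta>) \<le> L / m * dist \<eta> \<theta>" for \<eta> \<theta>
  proof (rule dist_bound)
    fix t
    let ?d = "dist \<eta> \<theta>"
    have I: "((\<lambda>s. L * ?d * exp (m * s)) has_integral (L * ?d / m * exp (m * c t) - L * ?d / m * exp (m * 0))) {0..c t}"
      using m c(2)[of t] by (intro fundamental_theorem_of_calculus)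
        (auto intro!: derivative_eq_intros simp flip: has_real_derivative_iff_has_vector_derivative)
    have hh: "norm (h \<eta> s - h \<theta> s) \<le> L * ?d * exp (m * s)" for s
    proof -
      have "norm (h \<eta> s - h \<theta> s) \<le> L * norm (exp (m * s) *\<^sub>R (apply_bcontfun \<eta> s - apply_bcontfun \<theta> s))"
        unfolding h_def scaleR_diff_right by (rule lipschitz_on_normD[OF X]) auto
      also have "\<dots> \<le> L * (exp (m * s) * ?d)"
        using dist_bounded[of \<eta> s \<theta>] L by (intro mult_left_mono) (auto simp: dist_norm)
      finally show ?thesis by (simp add: mult_ac)
    qed
    have "norm (integral {0..c t} (h \<eta>) - integral {0..c t} (h \<theta>))
        = norm (integral {0..c t} (\<lambda>s. h \<eta> s - h \<theta> s))"
      by (simp add: integral_diff[OF hi hi])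
    also have "\<dots> \<le> integral {0..c t} (\<lambda>s. L * ?d * exp (m * s))"
      by (rule integral_norm_bound_integral[OF integrable_diff[OF hi hi] has_integral_integrable[OF I]])
        (rule hh)
    also have "\<dots> = L * ?d / m * exp (m * c t) - L * ?d / m"
      using integral_unique[OF I] by simp
    also have "\<dots> \<le> L * ?d / m * exp (m * c t)" using L m by simp
    finally have "exp (- (m * c t)) * norm (integral {0..c t} (h \<eta>) - integral {0..c t} (h \<theta>))
        \<le> exp (- (m * c t)) * (L * ?d / m * exp (m * c t))"
      by (rule mult_left_mono) simp
    also have "\<dots> = L / m * ?d" by (simp add: mult_ac flip: exp_add)
    finally show "dist (F \<eta> t) (F \<theta> t) \<le> L / m * ?d"
      unfolding F P_def dist_norm scaleR_diff_right[symmetric] by simp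
  qed
  then obtain \<eta> where \<eta>: "F \<eta> = \<eta>"
    using banach_fix_type[of "L / m" F] L m by (auto simp: divide_less_eq)
  define \<gamma> where "\<gamma> s = exp (m * s) *\<^sub>R apply_bcontfun \<eta> s" for s
  have \<gamma>: "\<gamma> t = x0 + integral {0..t} (\<lambda>s. X (\<gamma> s))" if "t \<in> {0..T}" for t
  proof -
    have "c t = t" using that by (auto simp: c_def)
    then have "apply_bcontfun \<eta> t = exp (- (m * t)) *\<^sub>R (x0 + integral {0..t} (h \<eta>))"
      using F[of \<eta>] \<eta> by (simp add: P_def)
    then have "\<gamma> t = x0 + integral {0..t} (h \<eta>)"
      by (simp add: \<gamma>_def flip: exp_add)
    moreover have "h \<eta> = (\<lambda>s. X (\<gamma> s))" by (rule ext) (simp add: h_def \<gamma>_def)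
    ultimately show ?thesis by simp
  qed
  have "integral_curve X UNIV T \<gamma>"
    unfolding integral_curve_def
  proof (intro ballI conjI UNIV_I)
    fix s assume s: "s \<in> {0..T}"
    have "continuous_on {0..T} (\<lambda>s. X (\<gamma> s))"
      using h[of "{0..T}" \<eta>] by (simp add: h_def \<gamma>_def)
    then have "((\<lambda>t. x0 + integral {0..t} (\<lambda>s. X (\<gamma> s))) has_vector_derivative 0 + X (\<gamma> s)) (at s within {0..T})"
      by (intro has_vector_derivative_add has_vector_derivative_const integral_has_vector_derivative s)
    then show "(\<gamma> has_vector_derivative X (\<gamma> s)) (at s within {0..T})"
      unfolding add_0 by (rule has_vector_derivative_transform[OF s, rotated]) (rule \<gamma>)
  qed
  moreover have "\<gamma> 0 = x0" using \<gamma>[of 0] T by simp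
  ultimately show ?thesis by blast
qed

section \<open>Existence from an a priori bound\<close>

lemma compact_thickening_in_open:
  fixes Q U :: "'a::euclidean_space set"
  assumes "compact Q" "Q \<noteq> {}" "open U" "Q \<subseteq> U"
  obtains d where "d > 0" "compact {x. infdist x Q \<le> d}" "{x. infdist x Q \<le> d} \<subseteq> U"
proof -
  obtain e where e: "e > 0" "{x. infdist x Q \<le> e} \<subseteq> U"
    using compact_in_open_separated[OF assms(2,1,3,4)] by blast
  show ?thesis
    using that[OF e(1) compact_infdist_le[OF assms(2,1) e(1)] e(2)] .
qed

text \<open>
  Multiply \<open>X\<close> by a Lipschitz function that is \<open>1\<close> on \<open>Q\<close> and vanishes outside a compact
  neighbourhood \<open>N\<close> of \<open>Q\<close> in \<open>U\<close>. Outside \<open>N\<close> the product is zero even though nothing is known about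
  \<open>X\<close>; a pair of points with one in \<open>N\<close> and the other not is covered because the cutoff vanishes at
  the second point.
\<close>

lemma lipschitz_extension_from_compact:
  fixes X :: "'a::euclidean_space \<Rightarrow> 'b::euclidean_space"
  assumes X: "lipschitz_on_compacts U X" and U: "open U" and Q: "compact Q" "Q \<subseteq> U"
  shows "\<exists>G L. L-lipschitz_on UNIV G \<and> (\<forall>x\<in>Q. G x = X x)"
proof (cases "Q = {}")
  case True
  then show ?thesis using lipschitz_on_constant by blast
next
  case False
  obtain d where d: "d > 0" "compact {x. infdist x Q \<le> d}" "{x. infdist x Q \<le> d} \<subseteq> U"
    using compact_thickening_in_open[OF Q(1) False U Q(2)] .
  define N where "N = {x. infdist x Q \<le> d}"
  obtain L where L: "L-lipschitz_on N X"
    using X d unfolding lipschitz_on_compacts_def N_def by blast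
  have L0: "0 \<le> L" by (rule lipschitz_on_nonneg[OF L])
  have "bounded (X ` N)"
    using d(2) lipschitz_on_continuous_on[OF L] unfolding N_def
    by (intro compact_imp_bounded compact_continuous_image)
  then obtain m where m: "\<And>x. x \<in> N \<Longrightarrow> norm (X x) \<le> m" by (auto simp: bounded_iff)
  define cut where "cut x = max 0 (1 - infdist x Q / d)" for x
  have cut: "0 \<le> cut x" "cut x \<le> 1" for x
    using d(1) infdist_nonneg[of x Q] by (auto simp: cut_def)
  have cut0: "cut x = 0" if "x \<notin> N" for x using that d(1) by (auto simp: cut_def N_def)
  have cutlip: "\<bar>cut x - cut y\<bar> \<le> dist x y / d" for x y
  proof -
    have "\<bar>cut x - cut y\<bar> \<le> \<bar>infdist x Q / d - infdist y Q / d\<bar>" by (auto simp: cut_def)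
    also have "\<dots> = \<bar>infdist x Q - infdist y Q\<bar> / d" using d(1) by (simp flip: diff_divide_distrib)
    also have "\<dots> \<le> dist x y / d"
      using infdist_triangle[of x Q y] infdist_triangle[of y Q x] d(1)
      by (intro divide_right_mono) (auto simp: dist_commute abs_le_iff)
    finally show ?thesis .
  qed
  define G where "G x = cut x *\<^sub>R X x" for x
  have key: "dist (G x) (G y) \<le> (\<bar>m\<bar> / d + L) * dist x y" if "x \<in> N" for x y
  proof -
    have "G x - G y = (cut x - cut y) *\<^sub>R X x + cut y *\<^sub>R (X x - X y)"
      by (simp add: G_def algebra_simps)
    then have "dist (G x) (G y) \<le> \<bar>cut x - cut y\<bar> * norm (X x) + cut y * norm (X x - X y)"
      using norm_triangle_ineq[of "(cut x - cut y) *\<^sub>R X x" "cut y *\<^sub>R (X x - X y)"] cut(1)[of y]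
      by (simp add: dist_norm)
    also have "\<dots> \<le> dist x y / d * \<bar>m\<bar> + L * dist x y"
    proof (rule add_mono)
      show "\<bar>cut x - cut y\<bar> * norm (X x) \<le> dist x y / d * \<bar>m\<bar>"
        using m[OF that] d(1) by (intro mult_mono cutlip) auto
      show "cut y * norm (X x - X y) \<le> L * dist x y"
      proof (cases "y \<in> N")
        case True
        have "cut y * norm (X x - X y) \<le> 1 * norm (X x - X y)" by (intro mult_right_mono cut) auto
        then show ?thesis using lipschitz_onD[OF L that True] by (simp add: dist_norm)
      qed (use cut0 L0 in auto)
    qed
    finally show ?thesis by (simp add: algebra_simps)
  qed
  have "(\<bar>m\<bar> / d + L)-lipschitz_on UNIV G"
  proof (rule lipschitz_onI)
    fix x y
    show "dist (G x) (G y) \<le> (\<bar>m\<bar> / d + L) * dist x y"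
    proof (cases "x \<in> N \<or> y \<in> N")
      case True
      then show ?thesis using key[of x y] key[of y x] by (auto simp: dist_commute)
    next
      case False
      then show ?thesis using cut0 d(1) L0 by (auto simp: G_def)
    qed
  qed (use d(1) L0 in auto)
  moreover have "G x = X x" if "x \<in> Q" for x using that by (simp add: G_def cut_def)
  ultimately show ?thesis by blast
qed

text \<open>
  The continuation principle: a curve that cannot leave the open set \<open>V\<close> exists for as long as wanted.
  The a priori bound concerns curves in the compact set \<open>D\<close>, which contains \<open>V\<close>. A global
  curve of the extended field lies in \<open>V\<close> before its first exit time, hence in the closed set \<open>D\<close> up to
  and including that time, so the bound returns it to \<open>V\<close>, a contradiction.
\<close>

lemma trapped_integral_curve_exists:
  fixes X :: "'a::euclidean_space \<Rightarrow> 'a"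
  assumes X: "lipschitz_on_compacts U X" and U: "open U" and D: "compact D" "D \<subseteq> U"
    and V: "open V" "V \<subseteq> D" "x0 \<in> V" and T: "0 \<le> T"
    and apriori: "\<And>s \<gamma>. 0 \<le> s \<Longrightarrow> s \<le> T \<Longrightarrow> \<gamma> 0 = x0 \<Longrightarrow> integral_curve X D s \<gamma> \<Longrightarrow> \<gamma> s \<in> V"
  shows "\<exists>\<gamma>. \<gamma> 0 = x0 \<and> integral_curve X V T \<gamma>"
proof -
  obtain G L where G: "L-lipschitz_on UNIV G" "\<And>x. x \<in> D \<Longrightarrow> G x = X x"
    using lipschitz_extension_from_compact[OF X U D] by blast
  obtain \<gamma> where \<gamma>: "\<gamma> 0 = x0" "integral_curve G UNIV T \<gamma>"
    using global_integral_curve_exists[OF G(1) T] by blast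
  note cont = integral_curve_continuous_on[OF \<gamma>(2)]
  have V': "\<gamma> s \<in> V" if s: "s \<in> {0..T}" for s
  proof (rule ccontr)
    assume "\<gamma> s \<notin> V"
    define E where "E = {0..T} \<inter> \<gamma> -` (- V)"
    have "closed E" unfolding E_def
      by (rule continuous_closed_preimage[OF cont]) (use V(1) in auto)
    moreover have "bounded E" unfolding E_def by (rule bounded_subset[of "{0..T}"]) auto
    ultimately have "compact E" by (simp add: compact_eq_bounded_closed)
    moreover have "E \<noteq> {}" using s \<open>\<gamma> s \<notin> V\<close> by (auto simp: E_def)
    ultimately obtain s1 where s1: "s1 \<in> E" "\<And>r. r \<in> E \<Longrightarrow> s1 \<le> r"
      using compact_attains_inf[of E] by blast
    have s1T: "0 \<le> s1" "s1 \<le> T" "\<gamma> s1 \<notin> V" using s1(1) by (auto simp: E_def)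
    then have "0 < s1" using \<gamma>(1) V(3) by (cases "s1 = 0") auto
    have before: "\<gamma> r \<in> V" if "0 \<le> r" "r < s1" for r
      using s1(2)[of r] that s1T by (force simp: E_def)
    have "\<gamma> ` closure {0..<s1} \<subseteq> D"
      using \<open>0 < s1\<close> before V(2) compact_imp_closed[OF D(1)] s1T
      by (intro image_closure_subset) (auto intro: continuous_on_subset[OF cont])
    then have inD: "\<gamma> r \<in> D" if "r \<in> {0..s1}" for r
      using that \<open>0 < s1\<close> by auto
    have "integral_curve X D s1 \<gamma>"
      using integral_curve_restrict[OF \<gamma>(2) s1T(2)] inD G(2) by (auto simp: integral_curve_def)
    then show False using apriori[of s1 \<gamma>] s1T \<gamma>(1) by blast
  qed
  moreover have "G (\<gamma> s) = X (\<gamma> s)" if "s \<in> {0..T}" for s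
    using V'[OF that] V(2) G(2) by blast
  ultimately have "integral_curve X V T \<gamma>"
    using \<gamma>(2) by (simp add: integral_curve_def)
  then show ?thesis using \<gamma>(1) by blast
qed

section \<open>Hamiltonian flows in forward and backward time\<close>

lemma closed_segment_sign_image:
  "0 \<le> T \<Longrightarrow> \<sigma> = 1 \<or> \<sigma> = -1 \<Longrightarrow> closed_segment 0 (\<sigma> * T) = (\<lambda>s::real. \<sigma> * s) ` {0..T}"
  using image_uminus_atLeastAtMost[of 0 T] by (auto simp: closed_segment_eq_real_ivl)

text \<open>
  Negative times are reduced to positive ones by reversing the sign \<open>\<sigma>\<close> of the vector field.
\<close>

lemma ham_curve_iff_integral_curve:
  assumes T: "0 \<le> T" and \<sigma>: "\<sigma> = 1 \<or> \<sigma> = -1"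
  shows "ham_curve U F (\<sigma> * T) \<gamma> \<longleftrightarrow>
    integral_curve (\<lambda>x. \<sigma> *\<^sub>R ham_vf F x) U T (\<lambda>s. \<gamma> (\<sigma> * s))"
proof -
  have \<sigma>\<sigma>: "\<sigma> * (\<sigma> * s) = s" for s using \<sigma> by auto
  have \<sigma>d: "((\<lambda>s. \<sigma> * s) has_vector_derivative \<sigma>) (at s within S)" for s S
    by (auto intro!: derivative_eq_intros simp flip: has_real_derivative_iff_has_vector_derivative)
  have "(\<gamma> has_vector_derivative ham_vf F (\<gamma> (\<sigma> * s))) (at (\<sigma> * s) within (\<lambda>s. \<sigma> * s) ` {0..T}) \<longleftrightarrow>
     ((\<lambda>s. \<gamma> (\<sigma> * s)) has_vector_derivative \<sigma> *\<^sub>R ham_vf F (\<gamma> (\<sigma> * s))) (at s within {0..T})"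
    (is "?l \<longleftrightarrow> ?r") for s
  proof
    assume ?l
    then show ?r using vector_diff_chain_within[OF \<sigma>d] by (simp add: o_def)
  next
    assume r: ?r
    have im: "(\<lambda>s. \<sigma> * s) ` (\<lambda>s. \<sigma> * s) ` {0..T} = {0..T}"
      by (simp add: image_image \<sigma>\<sigma>)
    have "((\<lambda>s. \<gamma> (\<sigma> * s)) \<circ> (\<lambda>s. \<sigma> * s) has_vector_derivative \<sigma> *\<^sub>R \<sigma> *\<^sub>R ham_vf F (\<gamma> (\<sigma> * s)))
       (at (\<sigma> * s) within (\<lambda>s. \<sigma> * s) ` {0..T})"
      by (rule vector_diff_chain_within[OF \<sigma>d]) (use r in \<open>simp add: im \<sigma>\<sigma>\<close>)
    moreover have "\<sigma> * \<sigma> = 1" using \<sigma> by auto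
    ultimately show ?l by (simp add: o_def \<sigma>\<sigma>)
  qed
  then show ?thesis
    unfolding ham_curve_def integral_curve_def closed_segment_sign_image[OF assms] by auto
qed

lemma ham_flow_eqI:
  assumes T: "0 \<le> T" and \<sigma>: "\<sigma> = 1 \<or> \<sigma> = -1"
    and X: "lipschitz_on_compacts U (\<lambda>x. \<sigma> *\<^sub>R ham_vf F x)"
    and \<gamma>: "integral_curve (\<lambda>x. \<sigma> *\<^sub>R ham_vf F x) U T \<gamma>" and "\<gamma> 0 = x"
  shows "ham_flow_defined U F (\<sigma> * T) x" "ham_flow U F (\<sigma> * T) x = \<gamma> T"
proof -
  have \<sigma>\<sigma>: "\<sigma> * (\<sigma> * s) = s" for s using \<sigma> by auto
  let ?\<eta> = "\<lambda>s. \<gamma> (\<sigma> * s)"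
  have \<eta>: "ham_curve U F (\<sigma> * T) ?\<eta>" "?\<eta> 0 = x" "?\<eta> (\<sigma> * T) = \<gamma> T"
    using \<gamma> \<open>\<gamma> 0 = x\<close> by (auto simp: ham_curve_iff_integral_curve[OF T \<sigma>] \<sigma>\<sigma>)
  then show "ham_flow_defined U F (\<sigma> * T) x" unfolding ham_flow_defined_def by blast
  show "ham_flow U F (\<sigma> * T) x = \<gamma> T"
    unfolding ham_flow_def
  proof (rule the_equality)
    show "\<exists>\<eta>. ham_curve U F (\<sigma> * T) \<eta> \<and> \<eta> 0 = x \<and> \<eta> (\<sigma> * T) = \<gamma> T" using \<eta> by blast
    fix y assume "\<exists>\<eta>. ham_curve U F (\<sigma> * T) \<eta> \<and> \<eta> 0 = x \<and> \<eta> (\<sigma> * T) = y"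
    then obtain \<theta> where "ham_curve U F (\<sigma> * T) \<theta>" "\<theta> 0 = x" "\<theta> (\<sigma> * T) = y" by blast
    then show "y = \<gamma> T"
      using integral_curve_unique[OF X T _ \<gamma>, of "\<lambda>s. \<theta> (\<sigma> * s)"] \<open>\<gamma> 0 = x\<close>
      by (simp add: ham_curve_iff_integral_curve[OF T \<sigma>])
  qed
qed

section \<open>Flat functions have flat gradients\<close>

text \<open>
  Interpolation between \<open>P\<close>, which is flat, and the Lipschitz constant of its derivative: along a
  segment of length \<open>h\<close> in direction \<open>v\<close> the mean value theorem gives
  \<open>h |\<partial>\<^sub>v P(x)| \<le> |P(x + h v)| + |P(x)| + Lp h\<^sup>2\<close>. With \<open>h\<close> proportional to \<open>r\<^sup>k\<close>, both \<open>|P|\<close> terms are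
  \<open>O(r\<^sup>2\<^sup>k)\<close>, because \<open>\<zeta>\<close> moves by at most \<open>Lz h = O(r)\<close> along the segment; dividing by \<open>h\<close> leaves
  \<open>O(r\<^sup>k)\<close>. The radius \<open>r\<close> is a positive upper bound for \<open>|\<zeta> x|\<close> rather than \<open>|\<zeta> x|\<close> itself, so points
  with \<open>\<zeta> x = 0\<close> need no separate argument.
\<close>

lemma flat_function_has_flat_derivative:
  fixes P :: "'a::euclidean_space \<Rightarrow> real" and \<zeta> :: "'a \<Rightarrow> 'b::euclidean_space"
  assumes U: "open U" and P: "Ck_on (Suc (Suc 0)) U P" and \<zeta>: "lipschitz_on_compacts U \<zeta>"
    and flat: "\<And>Q k. compact Q \<Longrightarrow> Q \<subseteq> U \<Longrightarrow> \<exists>c. \<forall>x\<in>Q. \<bar>P x\<bar> \<le> c * norm (\<zeta> x) ^ k"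
    and D: "compact D" "D \<subseteq> U" and v: "norm v = 1" and k: "0 < k"
  shows "\<exists>c\<ge>0. \<forall>x\<in>D. \<forall>r. 0 < r \<and> r \<le> 1 \<and> norm (\<zeta> x) \<le> r \<longrightarrow>
    \<bar>frechet_derivative P (at x) v\<bar> \<le> c * r ^ k"
proof (cases "D = {}")
  case False
  obtain d where d: "d > 0" "compact {x. infdist x D \<le> d}" "{x. infdist x D \<le> d} \<subseteq> U"
    using compact_thickening_in_open[OF D(1) False U D(2)] .
  define N where "N = {x. infdist x D \<le> d}"
  have N: "compact N" "N \<subseteq> U" using d by (auto simp: N_def)
  define DP where "DP x = frechet_derivative P (at x) v" for x
  have "Ck_on (Suc 0) U DP" unfolding DP_def by (rule Ck_on_frechet_derivative[OF P])
  then obtain Lp where Lp: "Lp-lipschitz_on N DP"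
    using C1_imp_lipschitz_on_compacts[OF _ U] N unfolding lipschitz_on_compacts_def by blast
  obtain Lz where Lz: "Lz-lipschitz_on N \<zeta>"
    using \<zeta> N unfolding lipschitz_on_compacts_def by blast
  obtain c0 where c0: "\<And>x. x \<in> N \<Longrightarrow> \<bar>P x\<bar> \<le> c0 * norm (\<zeta> x) ^ (2 * k)"
    using flat[OF N] by blast
  define d' where "d' = min d 1"
  have d': "0 < d'" "d' \<le> d" "d' \<le> 1" using d(1) by (auto simp: d'_def)
  note L0 = lipschitz_on_nonneg[OF Lp] lipschitz_on_nonneg[OF Lz]
  define E where "E = \<bar>c0\<bar> * (1 + Lz) ^ (2 * k)"
  have "\<bar>DP x\<bar> \<le> (2 * E / d' + Lp * d') * r ^ k"
    if x: "x \<in> D" and r: "0 < r" "r \<le> 1" "norm (\<zeta> x) \<le> r" for x r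
  proof -
    define h where "h = d' * r ^ k"
    have "r ^ k \<le> 1" "r ^ k \<le> r"
      using r power_le_one[of r k] power_decreasing[of 1 k r] k by auto
    then have h: "0 < h" "h \<le> d" "h \<le> r"
      using r d' mult_mono[of d' d "r ^ k" 1] mult_mono[of d' 1 "r ^ k" r] by (auto simp: h_def)
    have inN: "x + t *\<^sub>R v \<in> N" if "0 \<le> t" "t \<le> h" for t
    proof -
      have "infdist (x + t *\<^sub>R v) D \<le> dist (x + t *\<^sub>R v) x" by (rule infdist_le[OF x])
      also have "\<dots> = t" using that v by (simp add: dist_norm)
      finally show ?thesis using that h by (simp add: N_def)
    qed
    have xN: "x \<in> N" using inN[of 0] h by simp
    have der: "((\<lambda>t. P (x + t *\<^sub>R v)) has_real_derivative DP (x + t *\<^sub>R v)) (at t)"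
      if "0 \<le> t" "t \<le> h" for t
    proof -
      have "(P has_derivative frechet_derivative P (at (x + t *\<^sub>R v))) (at (x + t *\<^sub>R v))"
        using inN[OF that] N(2) by (intro Ck_on_has_derivative[OF P]) auto
      moreover have "((\<lambda>t. x + t *\<^sub>R v) has_vector_derivative v) (at t)"
        by (auto intro!: derivative_eq_intros)
      ultimately show ?thesis
        using vector_derivative_diff_chain_within[of "\<lambda>t. x + t *\<^sub>R v" v t UNIV P]
        by (simp add: o_def DP_def has_real_derivative_iff_has_vector_derivative has_derivative_at_withinI)
    qed
    obtain \<xi> where \<xi>: "0 < \<xi>" "\<xi> < h" "P (x + h *\<^sub>R v) - P (x + 0 *\<^sub>R v) = (h - 0) * DP (x + \<xi> *\<^sub>R v)"
      using MVT2[OF h(1), of "\<lambda>t. P (x + t *\<^sub>R v)" "\<lambda>t. DP (x + t *\<^sub>R v)"] der by blast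
    have bound: "\<bar>P y\<bar> \<le> E * r ^ (2 * k)" if "y \<in> N" "norm (\<zeta> y) \<le> (1 + Lz) * r" for y
    proof -
      have "\<bar>P y\<bar> \<le> \<bar>c0\<bar> * norm (\<zeta> y) ^ (2 * k)"
        using c0[OF that(1)] by (rule order_trans) (auto intro: mult_right_mono)
      also have "\<dots> \<le> \<bar>c0\<bar> * ((1 + Lz) * r) ^ (2 * k)"
        by (intro mult_left_mono power_mono that) auto
      finally show ?thesis by (simp add: E_def power_mult_distrib mult_ac)
    qed
    have P1: "\<bar>P x\<bar> \<le> E * r ^ (2 * k)"
    proof (rule bound[OF xN])
      have "r \<le> (1 + Lz) * r" using r L0 by (simp add: algebra_simps)
      then show "norm (\<zeta> x) \<le> (1 + Lz) * r" using r(3) by linarith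
    qed
    have P2: "\<bar>P (x + h *\<^sub>R v)\<bar> \<le> E * r ^ (2 * k)"
    proof (rule bound[OF inN])
      have "norm (\<zeta> (x + h *\<^sub>R v) - \<zeta> x) \<le> Lz * norm (x + h *\<^sub>R v - x)"
        using inN[of h] h xN by (intro lipschitz_on_normD[OF Lz]) auto
      also have "\<dots> \<le> Lz * r" using h v L0 by (auto intro: mult_left_mono)
      finally have "norm (\<zeta> (x + h *\<^sub>R v) - \<zeta> x) \<le> Lz * r" .
      moreover have "norm (\<zeta> (x + h *\<^sub>R v)) \<le> norm (\<zeta> (x + h *\<^sub>R v) - \<zeta> x) + norm (\<zeta> x)"
        using norm_triangle_ineq[of "\<zeta> (x + h *\<^sub>R v) - \<zeta> x" "\<zeta> x"] by simp
      ultimately show "norm (\<zeta> (x + h *\<^sub>R v)) \<le> (1 + Lz) * r"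
        using r(3) by (simp add: algebra_simps)
    qed (use h in auto)
    have "\<bar>DP (x + \<xi> *\<^sub>R v) - DP x\<bar> \<le> Lp * norm (x + \<xi> *\<^sub>R v - x)"
      using lipschitz_on_normD[OF Lp, of "x + \<xi> *\<^sub>R v" x] inN[of \<xi>] \<xi> xN by simp
    also have "\<dots> \<le> Lp * h" using \<xi> v L0 by (auto intro: mult_left_mono)
    finally have "\<bar>DP x\<bar> \<le> \<bar>DP (x + \<xi> *\<^sub>R v)\<bar> + Lp * h" by linarith
    then have "h * \<bar>DP x\<bar> \<le> h * (\<bar>DP (x + \<xi> *\<^sub>R v)\<bar> + Lp * h)"
      using h(1) by (intro mult_left_mono) auto
    also have "\<dots> = \<bar>P (x + h *\<^sub>R v) - P x\<bar> + Lp * h * h"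
      using \<xi>(3) h(1) by (simp add: abs_mult algebra_simps)
    also have "\<dots> \<le> 2 * E * r ^ (2 * k) + Lp * h * h" using P1 P2 by linarith
    also have "r ^ (2 * k) = h * r ^ k / d'"
      using d' by (simp add: h_def power_mult power2_eq_square power_mult_distrib mult.commute[of 2])
    finally have "h * \<bar>DP x\<bar> \<le> h * (2 * E / d' * r ^ k + Lp * h)"
      by (simp add: algebra_simps)
    also have "2 * E / d' * r ^ k + Lp * h = (2 * E / d' + Lp * d') * r ^ k"
      by (simp add: h_def algebra_simps)
    finally have "h * \<bar>DP x\<bar> \<le> h * ((2 * E / d' + Lp * d') * r ^ k)" .
    then show ?thesis using h(1) by simp
  qed
  moreover have "0 \<le> 2 * E / d' + Lp * d'" using L0 d' by (simp add: E_def)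
  ultimately show ?thesis unfolding DP_def by blast
qed auto

section \<open>First integrals of the normal form\<close>

text \<open>
  Here \<open>Y\<close> is the Hamiltonian vector, at one point \<open>(z, z\<^sub>2)\<close>, of a function of \<open>z\<^sub>2\<close> and \<open>|z|\<^sup>2\<close>, with
  \<open>\<beta> l\<close> its derivative in the \<open>z\<^sub>2\<close> direction. The first component of \<open>Y\<close> is a rotation
  of \<open>z\<close>, hence orthogonal to \<open>z\<close>, and the second one is the symplectic gradient of \<open>\<beta> l\<close>, hence in the
  kernel of \<open>l\<close>.
\<close>

lemma model_hamiltonian_invariants:
  assumes l: "linear l"
    and Y: "\<And>v. model_sympl Y v = - (\<alpha> * (z \<bullet> fst v) + \<beta> * l (snd v))"
  shows "z \<bullet> fst Y = 0" "l (snd Y) = 0"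
proof -
  have "Im (fst Y) = - (\<alpha> * Re z)" "- Re (fst Y) = - (\<alpha> * Im z)"
    using Y[of "(1, 0)"] Y[of "(\<i>, 0)"] linear_0[OF l]
    by (simp_all add: model_sympl_def inner_complex_def)
  then show "z \<bullet> fst Y = 0" by (simp add: inner_complex_def)
  have 2: "snd Y $ 2 = - (\<beta> * l (axis 1 1))" "- (snd Y $ 1) = - (\<beta> * l (axis 2 1))"
    using Y[of "(0, axis 1 1)"] Y[of "(0, axis 2 1)"]
    by (simp_all add: model_sympl_def axis_def)
  have "snd Y = (snd Y $ 1) *\<^sub>R axis 1 1 + (snd Y $ 2) *\<^sub>R axis 2 1"
    by (simp add: vec_eq_iff forall_2 axis_def)
  then have "l (snd Y) = (snd Y $ 1) * l (axis 1 1) + (snd Y $ 2) * l (axis 2 1)"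
    using linear_add[OF l] linear_scale[OF l] by (metis real_scaleR_def)
  then show "l (snd Y) = 0" using 2 by (simp add: algebra_simps)
qed

text \<open>
  \<open>I\<close> and \<open>g\<close> below are the action \<open>|z\<^sub>1|\<^sup>2\<close> and the factor \<open>f(z\<^sub>2, |z\<^sub>1|\<^sup>2)\<close> of the normal form, transported
  to the phase space, where all estimates are made.
\<close>

locale magnetic_normal_form =
  fixes A :: "real^2 \<Rightarrow> real^2"
    and W :: "model set"
    and \<Phi> :: "model \<Rightarrow> phase"
    and f :: "(real^2) \<times> real \<Rightarrow> real"
  assumes smooth_A: "smooth_on UNIV A"
    and normal_form: "is_normal_form A W \<Phi> f"
begin

abbreviation "U \<equiv> \<Phi> ` W"
abbreviation "H \<equiv> mag_ham A"
abbreviation "K \<equiv> nf_ham W \<Phi> f"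
abbreviation "\<Psi> \<equiv> inv_into W \<Phi>"

definition z1 :: "phase \<Rightarrow> complex" where "z1 x = fst (\<Psi> x)"
definition I :: "phase \<Rightarrow> real" where "I x = (norm (z1 x))\<^sup>2"
definition g :: "phase \<Rightarrow> real" where "g x = f (snd (\<Psi> x), I x)"

lemma diffeo: "diffeo_on W \<Phi>"
  and sympl_\<Phi>: "z \<in> W \<Longrightarrow> sympl (frechet_derivative \<Phi> (at z) u) (frechet_derivative \<Phi> (at z) v) = model_sympl u v"
  and smooth_f: "smooth_on UNIV f"
  and flat: "flat_remainder W (\<lambda>z. H (\<Phi> z) - nf_model f z)"
  and base_in_U: "(q, A q) \<in> U"
  and z1_base: "z1 (q, A q) = 0"
  and f_base: "f (nf_base A W \<Phi> q, 0) = \<bar>mag_field A q\<bar>"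
  using normal_form unfolding is_normal_form_def symplectic_diffeo_def z1_def by blast+

lemma open_W: "open W" and inj: "inj_on \<Phi> W" and open_U: "open U"
  and Ck_\<Phi>: "Ck_on k W \<Phi>" and Ck_\<Psi>: "Ck_on k U \<Psi>"
  using diffeo by (auto simp: diffeo_on_def smooth_on_def)

lemma Ck_A: "Ck_on k UNIV A" and Ck_f: "Ck_on k UNIV f"
  using smooth_A smooth_f by (auto simp: smooth_on_def)

lemma \<Psi>_\<Phi>: "z \<in> W \<Longrightarrow> \<Psi> (\<Phi> z) = z" and \<Phi>_\<Psi>: "x \<in> U \<Longrightarrow> \<Phi> (\<Psi> x) = x"
  and \<Psi>_in_W: "x \<in> U \<Longrightarrow> \<Psi> x \<in> W"
  using inj by (auto simp: f_inv_into_f inv_into_into)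

lemma K_eq: "K x = I x * g x"
  by (simp add: nf_ham_def nf_model_def I_def g_def z1_def case_prod_unfold)

lemma Ck_z1: "Ck_on k U z1"
  unfolding z1_def by (rule Ck_on_linear_compose[OF bounded_linear_fst open_U Ck_\<Psi>])

lemma Ck_I: "Ck_on k U I"
  unfolding I_def power2_norm_eq_inner
  by (rule Ck_on_bilinear[OF bounded_bilinear_inner open_U Ck_z1 Ck_z1])

lemma Ck_g: "Ck_on k U g"
  unfolding g_def
  by (rule Ck_on_compose[OF open_U open_UNIV _ Ck_f])
    (auto intro: Ck_on_Pair Ck_on_linear_compose[OF bounded_linear_snd open_U Ck_\<Psi>] open_U Ck_I)

lemma Ck_K: "Ck_on k U K"
  unfolding K_eq[abs_def] by (rule Ck_on_bilinear[OF bounded_bilinear_mult open_U Ck_I Ck_g])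

lemma H_eq: "H x = (norm (snd x - A (fst x)))\<^sup>2"
  by (simp add: mag_ham_def case_prod_unfold)

lemma Ck_H: "Ck_on k UNIV H"
proof -
  have *: "Ck_on k UNIV (\<lambda>x. snd x - A (fst x) :: real^2)"
    by (intro Ck_on_diff open_UNIV Ck_on_bounded_linear bounded_linear_snd
        Ck_on_compose[OF open_UNIV open_UNIV _ Ck_A] bounded_linear_fst) auto
  show ?thesis
    unfolding H_eq[abs_def] power2_norm_eq_inner
    by (rule Ck_on_bilinear[OF bounded_bilinear_inner open_UNIV * *])
qed

lemma lipschitz_ham_vf_H: "lipschitz_on_compacts UNIV (ham_vf H)"
  by (intro C1_imp_lipschitz_on_compacts Ck_on_ham_vf open_UNIV Ck_H)

lemma lipschitz_ham_vf_K: "lipschitz_on_compacts U (ham_vf K)"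
  by (intro C1_imp_lipschitz_on_compacts Ck_on_ham_vf open_U Ck_K)

lemmas K_derivative = Ck_on_has_derivative[OF Ck_K]
lemmas I_derivative = Ck_on_has_derivative[OF Ck_I]
lemmas g_derivative = Ck_on_has_derivative[OF Ck_g]

text \<open>
  Transport of the model computation by the symplectic map: with \<open>Y = D\<Psi> X\<^sub>K\<close>, the identity
  \<open>model_sympl Y v = sympl X\<^sub>K (D\<Phi> v) = - dK (D\<Phi> v)\<close> shows that \<open>Y\<close> is the Hamiltonian vector of \<open>K \<circ> \<Phi>\<close>,
  whose derivative is explicit.
\<close>

lemma K_conserves:
  assumes x: "x \<in> U"
  shows "frechet_derivative I (at x) (ham_vf K x) = 0" "frechet_derivative g (at x) (ham_vf K x) = 0"
proof -
  define z where "z = \<Psi> x"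
  have z: "z \<in> W" "\<Phi> z = x" using x \<Psi>_in_W \<Phi>_\<Psi> by (auto simp: z_def)
  define \<Phi>' where "\<Phi>' = frechet_derivative \<Phi> (at z)"
  define \<Psi>' where "\<Psi>' = frechet_derivative \<Psi> (at x)"
  define f' where "f' = frechet_derivative f (at (snd z, (norm (fst z))\<^sup>2))"
  have \<Phi>': "(\<Phi> has_derivative \<Phi>') (at z)"
    unfolding \<Phi>'_def using Ck_\<Phi> z(1) by (rule Ck_on_has_derivative)
  have \<Psi>': "(\<Psi> has_derivative \<Psi>') (at x)"
    unfolding \<Psi>'_def using Ck_\<Psi> x by (rule Ck_on_has_derivative)
  have f': "(f has_derivative f') (at (snd z, (norm (fst z))\<^sup>2))"
    unfolding f'_def by (rule Ck_on_has_derivative[OF Ck_f]) simp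
  have lin: "linear f'" using f' has_derivative_linear by blast
  define Y where "Y = \<Psi>' (ham_vf K x)"
  have "((\<lambda>y. \<Phi> (\<Psi> y)) has_derivative \<Phi>' \<circ> \<Psi>') (at x)"
    using diff_chain_at[OF \<Psi>'] \<Phi>' by (simp add: o_def z_def)
  moreover have "((\<lambda>y. \<Phi> (\<Psi> y)) has_derivative (\<lambda>v. v)) (at x)"
    by (rule has_derivative_transform_within_open[OF has_derivative_ident open_U x]) (simp add: \<Phi>_\<Psi>)
  ultimately have "\<Phi>' \<circ> \<Psi>' = (\<lambda>v. v)" by (rule has_derivative_unique)
  then have \<Phi>Y: "\<Phi>' Y = ham_vf K x" by (metis Y_def comp_apply)
  have K\<Phi>: "frechet_derivative K (at x) (\<Phi>' v) =
      2 * (fst z \<bullet> fst v) * f (snd z, (norm (fst z))\<^sup>2)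
        + (norm (fst z))\<^sup>2 * f' (snd v, 2 * (fst z \<bullet> fst v))" for v
  proof -
    have n: "((\<lambda>w. (norm (fst w))\<^sup>2) has_derivative (\<lambda>v. 2 * (fst z \<bullet> fst v))) (at z)"
      unfolding power2_norm_eq_inner
      by (auto intro!: derivative_eq_intros simp: inner_commute)
    have p: "((\<lambda>w. (snd w, (norm (fst w))\<^sup>2)) has_derivative (\<lambda>v. (snd v, 2 * (fst z \<bullet> fst v)))) (at z)"
      by (intro has_derivative_Pair n has_derivative_snd has_derivative_ident)
    have fp: "((\<lambda>w. f (snd w, (norm (fst w))\<^sup>2)) has_derivative (\<lambda>v. f' (snd v, 2 * (fst z \<bullet> fst v)))) (at z)"
      using diff_chain_at[OF p] f' by (simp add: o_def)
    have "((\<lambda>w. (norm (fst w))\<^sup>2 * f (snd w, (norm (fst w))\<^sup>2)) has_derivative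
        (\<lambda>v. (norm (fst z))\<^sup>2 * f' (snd v, 2 * (fst z \<bullet> fst v))
           + 2 * (fst z \<bullet> fst v) * f (snd z, (norm (fst z))\<^sup>2))) (at z)"
      using n fp by (rule has_derivative_mult)
    moreover have "((\<lambda>w. (norm (fst w))\<^sup>2 * f (snd w, (norm (fst w))\<^sup>2)) has_derivative
        frechet_derivative K (at x) \<circ> \<Phi>') (at z)"
    proof (rule has_derivative_transform_within_open[OF _ open_W z(1)])
      show "(K \<circ> \<Phi> has_derivative frechet_derivative K (at x) \<circ> \<Phi>') (at z)"
        using diff_chain_at[OF \<Phi>'] K_derivative x z(2) by metis
    qed (simp add: nf_ham_def nf_model_def \<Psi>_\<Phi> case_prod_unfold)
    ultimately have "(\<lambda>v. (norm (fst z))\<^sup>2 * f' (snd v, 2 * (fst z \<bullet> fst v))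
           + 2 * (fst z \<bullet> fst v) * f (snd z, (norm (fst z))\<^sup>2)) = frechet_derivative K (at x) \<circ> \<Phi>'"
      by (rule has_derivative_unique)
    from fun_cong[OF this, of v] show ?thesis by simp
  qed
  have split: "f' (w, t) = f' (w, 0) + t * f' (0, 1)" for w t
  proof -
    have "(w, t) = (w, 0) + t *\<^sub>R (0, 1)" by simp
    then show ?thesis using linear_add[OF lin] linear_scale[OF lin] by (metis real_scaleR_def)
  qed
  have "model_sympl Y v = - (2 * (f (snd z, (norm (fst z))\<^sup>2) + (norm (fst z))\<^sup>2 * f' (0, 1)) * (fst z \<bullet> fst v)
      + (norm (fst z))\<^sup>2 * f' (snd v, 0))" for v
  proof -
    have "model_sympl Y v = sympl (ham_vf K x) (\<Phi>' v)"
      using sympl_\<Phi>[OF z(1)] \<Phi>Y by (metis \<Phi>'_def)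
    also have "\<dots> = - frechet_derivative K (at x) (\<Phi>' v)"
      using sympl_ham_vf K_derivative[OF x] differentiable_def by blast
    finally show ?thesis unfolding K\<Phi> split[of _ "2 * (fst z \<bullet> fst v)"] by (simp add: algebra_simps)
  qed
  moreover have "linear (\<lambda>w. f' (w, 0))"
    using linear_compose[OF _ lin, of "\<lambda>w. (w, 0)"] by (simp add: o_def linear_iff)
  ultimately have inv: "fst z \<bullet> fst Y = 0" "f' (snd Y, 0) = 0"
    using model_hamiltonian_invariants[of "\<lambda>w. f' (w, 0)" Y] by auto
  have dI: "(I has_derivative (\<lambda>v. 2 * (fst z \<bullet> fst (\<Psi>' v)))) (at x)"
    unfolding I_def z1_def power2_norm_eq_inner
    using \<Psi>' by (auto intro!: derivative_eq_intros simp: inner_commute z_def)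
  have "(\<lambda>v. 2 * (fst z \<bullet> fst (\<Psi>' v))) = frechet_derivative I (at x)"
    by (rule frechet_derivative_at[OF dI])
  from fun_cong[OF this, of "ham_vf K x"] show "frechet_derivative I (at x) (ham_vf K x) = 0"
    using inv by (simp add: Y_def)
  have "((\<lambda>y. (snd (\<Psi> y), I y)) has_derivative (\<lambda>v. (snd (\<Psi>' v), 2 * (fst z \<bullet> fst (\<Psi>' v))))) (at x)"
    by (intro has_derivative_Pair dI has_derivative_snd \<Psi>')
  then have "(g has_derivative (\<lambda>v. f' (snd (\<Psi>' v), 2 * (fst z \<bullet> fst (\<Psi>' v))))) (at x)"
    using diff_chain_at[of "\<lambda>y. (snd (\<Psi> y), I y)" _ x f f'] f'
    by (simp add: o_def g_def[abs_def] I_def z1_def z_def)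
  from fun_cong[OF frechet_derivative_at[OF this], of "ham_vf K x"]
  show "frechet_derivative g (at x) (ham_vf K x) = 0"
    using inv by (simp add: Y_def)
qed

section \<open>The vector fields of \<open>H\<close> and \<open>K\<close> agree to infinite order\<close>

lemma remainder_flat:
  assumes "compact Q" "Q \<subseteq> U"
  shows "\<exists>c. \<forall>x\<in>Q. \<bar>H x - K x\<bar> \<le> c * norm (z1 x) ^ k"
proof -
  have "compact (\<Psi> ` Q)"
    using Ck_on_imp_continuous_on[OF Ck_\<Psi>] assms
    by (intro compact_continuous_image) (auto elim: continuous_on_subset)
  moreover have "\<Psi> ` Q \<subseteq> W" using assms(2) \<Psi>_in_W by blast
  ultimately obtain c where c: "\<forall>z\<in>\<Psi> ` Q. \<bar>H (\<Phi> z) - nf_model f z\<bar> \<le> c * norm (fst z) ^ k"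
    using flat unfolding flat_remainder_def by blast
  have "\<bar>H x - K x\<bar> \<le> c * norm (z1 x) ^ k" if "x \<in> Q" for x
  proof -
    have "\<Phi> (\<Psi> x) = x" using that assms(2) \<Phi>_\<Psi> by blast
    then show ?thesis using bspec[OF c imageI[OF that]] by (simp add: z1_def nf_ham_def)
  qed
  then show ?thesis by blast
qed

lemma ham_vf_diff_flat:
  assumes D: "compact D" "D \<subseteq> U" and k: "0 < k"
  shows "\<exists>c\<ge>0. \<forall>x\<in>D. \<forall>r. 0 < r \<and> r \<le> 1 \<and> norm (z1 x) \<le> r \<longrightarrow>
    norm (ham_vf H x - ham_vf K x) \<le> c * r ^ k"
proof -
  define P where "P x = H x - K x" for x
  have CkP: "Ck_on k U P" for k
    unfolding P_def by (intro Ck_on_diff open_U Ck_K Ck_on_subset[OF Ck_H]) auto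
  have "\<exists>c\<ge>0. \<forall>x\<in>D. \<forall>r. 0 < r \<and> r \<le> 1 \<and> norm (z1 x) \<le> r \<longrightarrow>
    \<bar>frechet_derivative P (at x) v\<bar> \<le> c * r ^ k" if "norm v = 1" for v
    by (rule flat_function_has_flat_derivative[OF open_U CkP
          C1_imp_lipschitz_on_compacts[OF Ck_z1 open_U] _ D that k])
      (use remainder_flat in \<open>auto simp: P_def\<close>)
  then obtain c where c: "\<And>v. norm v = 1 \<Longrightarrow> 0 \<le> c v"
    "\<And>v x r. norm v = 1 \<Longrightarrow> x \<in> D \<Longrightarrow> 0 < r \<Longrightarrow> r \<le> 1 \<Longrightarrow> norm (z1 x) \<le> r \<Longrightarrow>
      \<bar>frechet_derivative P (at x) v\<bar> \<le> c v * r ^ k"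
    by metis
  have ham_P: "ham_vf H x - ham_vf K x = ham_vf P x" if "x \<in> U" for x
  proof -
    have "(P has_derivative (\<lambda>v. frechet_derivative H (at x) v - frechet_derivative K (at x) v)) (at x)"
      unfolding P_def
      by (intro has_derivative_diff K_derivative Ck_on_has_derivative[OF Ck_H] that UNIV_I)
    then have "frechet_derivative P (at x) = (\<lambda>v. frechet_derivative H (at x) v - frechet_derivative K (at x) v)"
      by (rule frechet_derivative_at[symmetric])
    then show ?thesis by (simp add: ham_vf_def prod_eq_iff vec_eq_iff)
  qed
  let ?e = "\<lambda>i. (axis i 1, 0) :: phase" and ?e' = "\<lambda>i. (0, axis i 1) :: phase"
  let ?c = "\<Sum>i\<in>UNIV. c (?e' i) + c (?e i)"
  have e: "norm (?e i) = 1" "norm (?e' i) = 1" for i by (simp_all add: norm_Pair)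
  have "norm (ham_vf H x - ham_vf K x) \<le> ?c * r ^ k"
    if "x \<in> D" "0 < r" "r \<le> 1" "norm (z1 x) \<le> r" for x r
  proof -
    have "norm (ham_vf P x) \<le> (\<Sum>i\<in>UNIV. c (?e' i) * r ^ k + c (?e i) * r ^ k)"
      unfolding ham_vf_eq_sum
    proof (rule sum_norm_le)
      fix i :: 2
      show "norm (frechet_derivative P (at x) (?e' i) *\<^sub>R ?e i - frechet_derivative P (at x) (?e i) *\<^sub>R ?e' i)
          \<le> c (?e' i) * r ^ k + c (?e i) * r ^ k"
        by (rule order_trans[OF norm_triangle_ineq4])
          (unfold norm_scaleR e mult_1_right real_norm_def, intro add_mono c(2) e that)
    qed
    then show ?thesis
      using ham_P[of x] that(1) D(2) by (auto simp: sum_distrib_right distrib_right)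
  qed
  moreover have "0 \<le> ?c" by (intro sum_nonneg add_nonneg_nonneg c(1) e)
  ultimately show ?thesis by blast
qed

text \<open>
  The quantities \<open>I\<close> and \<open>g\<close> drift along \<open>X\<close> with speed \<open>O(|z\<^sub>1|\<^sup>\<infinity>)\<close>, uniformly on \<open>D\<close>. The fields of \<open>H\<close>
  and \<open>K\<close>, with either sign, enter the confinement argument only through this property.
\<close>

definition adiabatic_on :: "phase set \<Rightarrow> (phase \<Rightarrow> phase) \<Rightarrow> bool" where
  "adiabatic_on D X \<longleftrightarrow> (\<forall>k>0. \<exists>c\<ge>0. \<forall>x\<in>D. \<forall>r. 0 < r \<and> r \<le> 1 \<and> norm (z1 x) \<le> r \<longrightarrow>
     \<bar>frechet_derivative I (at x) (X x)\<bar> \<le> c * r ^ k \<and> \<bar>frechet_derivative g (at x) (X x)\<bar> \<le> c * r ^ k)"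

lemma adiabatic_on_scaleR:
  assumes "adiabatic_on D X" "D \<subseteq> U" "\<bar>\<sigma>\<bar> = 1" shows "adiabatic_on D (\<lambda>x. \<sigma> *\<^sub>R X x)"
proof -
  have "\<bar>frechet_derivative I (at x) (\<sigma> *\<^sub>R X x)\<bar> = \<bar>frechet_derivative I (at x) (X x)\<bar> \<and>
    \<bar>frechet_derivative g (at x) (\<sigma> *\<^sub>R X x)\<bar> = \<bar>frechet_derivative g (at x) (X x)\<bar>" if "x \<in> D" for x
  proof -
    have "x \<in> U" using that assms(2) by blast
    then show ?thesis
      using linear_scale[OF has_derivative_linear[OF I_derivative], of x \<sigma> "X x"]
        linear_scale[OF has_derivative_linear[OF g_derivative], of x \<sigma> "X x"] assms(3)
      by (simp add: abs_mult)
  qed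
  then show ?thesis using assms(1) unfolding adiabatic_on_def by simp
qed

lemma adiabatic_on_K:
  assumes "D \<subseteq> U" shows "adiabatic_on D (ham_vf K)"
proof -
  have "\<forall>x\<in>D. frechet_derivative I (at x) (ham_vf K x) = 0 \<and> frechet_derivative g (at x) (ham_vf K x) = 0"
    using K_conserves assms by blast
  then show ?thesis unfolding adiabatic_on_def by (intro allI impI exI[of _ 0]) simp
qed

text \<open>
  The field of \<open>K\<close> contributes nothing to the drift, so only the flat difference of the two fields
  remains.
\<close>

lemma adiabatic_on_H:
  assumes D: "compact D" "D \<subseteq> U" shows "adiabatic_on D (ham_vf H)"
  unfolding adiabatic_on_def
proof (intro allI impI)
  fix k :: nat assume k: "0 < k"
  obtain c where c: "0 \<le> c" "\<And>x r. x \<in> D \<Longrightarrow> 0 < r \<Longrightarrow> r \<le> 1 \<Longrightarrow> norm (z1 x) \<le> r \<Longrightarrow>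
      norm (ham_vf H x - ham_vf K x) \<le> c * r ^ k"
    using ham_vf_diff_flat[OF D k] by metis
  obtain mI where mI: "0 \<le> mI" "\<And>x v. x \<in> D \<Longrightarrow> norm (frechet_derivative I (at x) v) \<le> mI * norm v"
    using C1_derivative_bounded_on_compact[OF Ck_I D] by metis
  obtain mg where mg: "0 \<le> mg" "\<And>x v. x \<in> D \<Longrightarrow> norm (frechet_derivative g (at x) v) \<le> mg * norm v"
    using C1_derivative_bounded_on_compact[OF Ck_g D] by metis
  have bound: "\<forall>x\<in>D. \<forall>r. 0 < r \<and> r \<le> 1 \<and> norm (z1 x) \<le> r \<longrightarrow>
     \<bar>frechet_derivative I (at x) (ham_vf H x)\<bar> \<le> (mI + mg) * c * r ^ k \<and>
     \<bar>frechet_derivative g (at x) (ham_vf H x)\<bar> \<le> (mI + mg) * c * r ^ k"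
  proof (intro ballI allI impI, elim conjE)
    fix x r assume x: "x \<in> D" and r: "0 < r" "r \<le> 1" "norm (z1 x) \<le> r"
    have xU: "x \<in> U" using x D(2) by blast
    let ?d = "ham_vf H x - ham_vf K x"
    have "frechet_derivative I (at x) (ham_vf H x) = frechet_derivative I (at x) ?d"
      "frechet_derivative g (at x) (ham_vf H x) = frechet_derivative g (at x) ?d"
      using K_conserves[OF xU] linear_diff[OF has_derivative_linear[OF I_derivative[OF xU]]]
        linear_diff[OF has_derivative_linear[OF g_derivative[OF xU]]] by simp_all
    moreover have "m * norm ?d \<le> (mI + mg) * c * r ^ k" if "0 \<le> m" "m \<le> mI + mg" for m
      using mult_mono[OF that(2) c(2)[OF x r]] that by (simp add: mult.assoc)
    ultimately show "\<bar>frechet_derivative I (at x) (ham_vf H x)\<bar> \<le> (mI + mg) * c * r ^ k \<and>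
        \<bar>frechet_derivative g (at x) (ham_vf H x)\<bar> \<le> (mI + mg) * c * r ^ k"
      using mI(2)[OF x, of ?d] mg(2)[OF x, of ?d] mI(1) mg(1)
      by (smt (verit) real_norm_def)
  qed
  have "0 \<le> (mI + mg) * c" using mI mg c by simp
  then show "\<exists>c\<ge>0. \<forall>x\<in>D. \<forall>r. 0 < r \<and> r \<le> 1 \<and> norm (z1 x) \<le> r \<longrightarrow>
     \<bar>frechet_derivative I (at x) (ham_vf H x)\<bar> \<le> c * r ^ k \<and>
     \<bar>frechet_derivative g (at x) (ham_vf H x)\<bar> \<le> c * r ^ k"
    using bound by (intro exI[of _ "(mI + mg) * c"] conjI)
qed

section \<open>A compact tube around the zero energy surface\<close>

definition tube :: "real \<Rightarrow> real \<Rightarrow> phase set" where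
  "tube M \<rho> = {(q, p). norm q \<le> M \<and> norm (p - A q) \<le> \<rho>}"

lemma mem_tube: "x \<in> tube M \<rho> \<longleftrightarrow> norm (fst x) \<le> M \<and> norm (snd x - A (fst x)) \<le> \<rho>"
  by (auto simp: tube_def)

lemma compact_tube: "compact (tube M \<rho>)"
proof -
  have eq: "tube M \<rho> = (\<lambda>(q, w). (q, A q + w)) ` (cball 0 M \<times> cball 0 \<rho>)"
  proof (intro equalityI subsetI)
    fix x assume "x \<in> tube M \<rho>"
    then show "x \<in> (\<lambda>(q, w). (q, A q + w)) ` (cball 0 M \<times> cball 0 \<rho>)"
      by (intro image_eqI[of _ _ "(fst x, snd x - A (fst x))"]) (auto simp: mem_tube)
  qed (auto simp: mem_tube)
  have "continuous_on (cball 0 M \<times> cball 0 \<rho>) (\<lambda>(q, w). (q, A q + w))"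
    unfolding case_prod_unfold
    by (intro continuous_intros continuous_on_compose2[OF Ck_on_imp_continuous_on[OF Ck_A]]) auto
  then show ?thesis
    unfolding eq by (rule compact_continuous_image[OF _ compact_Times[OF compact_cball compact_cball]])
qed

lemma tube_in_U:
  assumes "0 < M" obtains \<rho> where "0 < \<rho>" "tube M \<rho> \<subseteq> U"
proof -
  have sub: "tube M 0 \<subseteq> U"
  proof
    fix x assume "x \<in> tube M 0"
    then have "snd x = A (fst x)" by (simp add: mem_tube)
    then have "(fst x, snd x) \<in> U" using base_in_U[of "fst x"] by (simp only:)
    then show "x \<in> U" by (simp only: prod.collapse)
  qed
  have base: "(q, A q) \<in> tube M 0" if "norm q \<le> M" for q using that by (simp add: mem_tube)
  have ne: "tube M 0 \<noteq> {}" using base[of 0] assms by auto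
  obtain d where d: "d > 0" "compact {x. infdist x (tube M 0) \<le> d}" "{x. infdist x (tube M 0) \<le> d} \<subseteq> U"
    by (rule compact_thickening_in_open[OF compact_tube ne open_U sub])
  have "infdist x (tube M 0) \<le> d" if "x \<in> tube M d" for x
  proof -
    have "infdist x (tube M 0) \<le> dist x (fst x, A (fst x))"
      using that by (intro infdist_le base) (simp add: mem_tube)
    also have "\<dots> = norm (snd x - A (fst x))" by (cases x) (simp add: dist_Pair_Pair dist_norm)
    finally show ?thesis using that by (simp add: mem_tube)
  qed
  then show ?thesis using that[OF d(1)] d(3) by blast
qed

text \<open>
  The first and the third bound compare a point \<open>(q, p)\<close> with its projection \<open>(q, A q)\<close>, at distance
  \<open>\<surd>H\<close>: there \<open>z\<^sub>1 = 0\<close> and \<open>g = |B|\<close>, and \<open>z\<^sub>1\<close> and \<open>g\<close> are Lipschitz on the tube. The bound of \<open>H\<close> by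
  \<open>I\<close> reads off \<open>H = I g + O(|z\<^sub>1|\<^sup>2)\<close> with \<open>g\<close> bounded.
\<close>

lemma tube_estimates:
  assumes \<rho>: "0 < \<rho>" and D: "tube M \<rho> \<subseteq> U"
  obtains c where "0 < c" "\<forall>x\<in>tube M \<rho>. I x \<le> c * H x \<and> H x \<le> c * I x \<and>
    \<bar>g x - \<bar>mag_field A (fst x)\<bar>\<bar> \<le> c * sqrt (H x)"
proof -
  let ?D = "tube M \<rho>"
  obtain L where L: "L-lipschitz_on ?D z1"
    by (rule lipschitz_on_compactsE[OF C1_imp_lipschitz_on_compacts[OF Ck_z1 open_U] compact_tube D])
  obtain Lg where Lg: "Lg-lipschitz_on ?D g"
    by (rule lipschitz_on_compactsE[OF C1_imp_lipschitz_on_compacts[OF Ck_g open_U] compact_tube D])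
  obtain c0 where c0: "\<And>x. x \<in> ?D \<Longrightarrow> \<bar>H x - K x\<bar> \<le> c0 * norm (z1 x) ^ 2"
    using remainder_flat[OF compact_tube D, of 2] by fast
  have "bounded (g ` ?D)"
    using lipschitz_on_continuous_on[OF Lg] by (intro compact_imp_bounded compact_continuous_image compact_tube)
  then obtain G where G: "\<And>x. x \<in> ?D \<Longrightarrow> \<bar>g x\<bar> \<le> G" by (auto simp: bounded_iff)
  have sqrtH: "sqrt (H x) = norm (snd x - A (fst x))" for x by (simp add: H_eq)
  have base: "(fst x, A (fst x)) \<in> ?D" "norm (x - (fst x, A (fst x))) = sqrt (H x)" if "x \<in> ?D" for x
    using that \<rho> by (auto simp: mem_tube sqrtH norm_Pair[of 0] minus_prod_def norm_prod_def)
  define c where "c = 1 + L\<^sup>2 + \<bar>G\<bar> + \<bar>c0\<bar> + \<bar>Lg\<bar>"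
  show ?thesis
  proof (rule that[of c], goal_cases)
    case 1
    show "0 < c" by (simp add: c_def add_pos_nonneg)
  next
    case 2
    show ?case
    proof (intro ballI conjI)
      fix x assume x: "x \<in> ?D"
      have H0: "0 \<le> H x" and I0: "0 \<le> I x" by (auto simp: H_eq I_def)
      have "norm (z1 x - z1 (fst x, A (fst x))) \<le> L * sqrt (H x)"
        using lipschitz_on_normD[OF L x base(1)[OF x]] base(2)[OF x] by simp
      then have "I x \<le> (L * sqrt (H x))\<^sup>2"
        unfolding I_def z1_base by (intro power_mono) auto
      also have "\<dots> = L\<^sup>2 * H x" using H0 by (simp add: power_mult_distrib)
      also have "\<dots> \<le> c * H x" using H0 by (intro mult_right_mono) (auto simp: c_def)
      finally show "I x \<le> c * H x" .
      have "H x \<le> I x * g x + c0 * I x" using c0[OF x] by (simp add: K_eq I_def abs_le_iff)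
      also have "\<dots> = (g x + c0) * I x" by (simp add: algebra_simps)
      also have "\<dots> \<le> c * I x"
      proof (rule mult_right_mono[OF _ I0])
        show "g x + c0 \<le> c" using G[OF x] zero_le_power2[of L] unfolding c_def by linarith
      qed
      finally show "H x \<le> c * I x" .
      have "g (fst x, A (fst x)) = \<bar>mag_field A (fst x)\<bar>"
        using z1_base[of "fst x"] f_base[of "fst x"] by (simp add: g_def I_def nf_base_def)
      then have "\<bar>g x - \<bar>mag_field A (fst x)\<bar>\<bar> \<le> Lg * sqrt (H x)"
        using lipschitz_on_normD[OF Lg x base(1)[OF x]] base(2)[OF x] by simp
      also have "\<dots> \<le> c * sqrt (H x)"
      proof (rule mult_right_mono)
        show "Lg \<le> c" using zero_le_power2[of L] unfolding c_def by linarith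
      qed (use H0 in simp)
      finally show "\<bar>g x - \<bar>mag_field A (fst x)\<bar>\<bar> \<le> c * sqrt (H x)" .
    qed
  qed
qed

section \<open>Confinement over polynomially long times\<close>

lemma open_sublevel_tube:
  "open {x \<in> U. norm (fst x) < M \<and> norm (snd x - A (fst x)) < \<rho> \<and> I x < \<kappa>}"
proof -
  have cA: "continuous_on UNIV A" by (rule Ck_on_imp_continuous_on[OF Ck_A])
  have cI: "continuous_on U I" by (rule Ck_on_imp_continuous_on[OF Ck_I])
  have 1: "open {x::phase. norm (fst x) < M}" "open {x. norm (snd x - A (fst x)) < \<rho>}"
    by (intro open_Collect_less continuous_intros continuous_on_compose2[OF cA]; simp)+
  have 2: "open (U \<inter> I -` {..<\<kappa>})"
    by (rule continuous_open_preimage[OF cI open_U open_lessThan])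
  have eq: "{x \<in> U. norm (fst x) < M \<and> norm (snd x - A (fst x)) < \<rho> \<and> I x < \<kappa>} =
     {x. norm (fst x) < M} \<inter> {x. norm (snd x - A (fst x)) < \<rho>} \<inter> (U \<inter> I -` {..<\<kappa>})"
    by auto
  show ?thesis unfolding eq by (intro open_Int 1 2)
qed

definition low_tube :: "real \<Rightarrow> real \<Rightarrow> real \<Rightarrow> phase set" where
  "low_tube M \<rho> \<kappa> = {x \<in> tube M \<rho>. I x \<le> \<kappa>}"

lemma compact_low_tube:
  assumes "tube M \<rho> \<subseteq> U" shows "compact (low_tube M \<rho> \<kappa>)"
proof -
  have "continuous_on (tube M \<rho>) I"
    using Ck_on_imp_continuous_on[OF Ck_I] assms by (rule continuous_on_subset)
  then have "closed (tube M \<rho> \<inter> I -` {..\<kappa>})"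
    using compact_imp_closed[OF compact_tube] closed_atMost by (rule continuous_closed_preimage)
  then have "compact (tube M \<rho> \<inter> (tube M \<rho> \<inter> I -` {..\<kappa>}))"
    using compact_tube by (rule compact_Int_closed[rotated])
  moreover have "tube M \<rho> \<inter> (tube M \<rho> \<inter> I -` {..\<kappa>}) = low_tube M \<rho> \<kappa>"
    by (auto simp: low_tube_def)
  ultimately show ?thesis by simp
qed

text \<open>
  The bootstrap assumption is \<open>I \<le> 2 c a \<epsilon>\<close> in the tube, twice the bound \<open>c a \<epsilon>\<close> that holds at the
  start. Under it \<open>I\<close> and \<open>g\<close> change by at most \<open>c2 \<epsilon>\<^sup>2\<close> up to time \<open>b / \<epsilon>\<^sup>N\<close>, and each of the three
  defining inequalities of the region becomes strict at the final time: \<open>I\<close> has moved by less than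
  \<open>c a \<epsilon>\<close>, the energy is at most \<open>c I = O(\<epsilon>)\<close>, and \<open>B < C\<close> excludes \<open>|q| = M\<close>.
\<close>

lemma confinement:
  fixes a b :: real and N :: nat
  assumes pos: "\<And>q. 0 < mag_field A q" and M: "\<forall>q. M \<le> norm q \<longrightarrow> C \<le> mag_field A q" and C0: "C0 < C"
    and \<rho>: "0 < \<rho>" and D: "tube M \<rho> \<subseteq> U"
    and c0: "0 < c"
    and estimates: "\<forall>x\<in>tube M \<rho>. I x \<le> c * H x \<and> H x \<le> c * I x \<and>
      \<bar>g x - \<bar>mag_field A (fst x)\<bar>\<bar> \<le> c * sqrt (H x)"
    and X: "lipschitz_on_compacts U X" "adiabatic_on (tube M \<rho>) X"
    and a: "0 < a" and b: "0 \<le> b"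
  shows "\<forall>\<^sub>F \<epsilon> in at_right 0. \<forall>x T. mag_field A (fst x) \<le> C0 \<and> H x \<le> a * \<epsilon> \<and> 0 \<le> T \<and> T \<le> b / \<epsilon> ^ N \<longrightarrow>
     (\<exists>\<gamma>. \<gamma> 0 = x \<and> integral_curve X (low_tube M \<rho> (2 * c * a * \<epsilon>)) T \<gamma>)"
proof -
  have c: "0 < c" "\<And>x. x \<in> tube M \<rho> \<Longrightarrow> I x \<le> c * H x" "\<And>x. x \<in> tube M \<rho> \<Longrightarrow> H x \<le> c * I x"
      "\<And>x. x \<in> tube M \<rho> \<Longrightarrow> \<bar>g x - \<bar>mag_field A (fst x)\<bar>\<bar> \<le> c * sqrt (H x)"
    using c0 estimates by blast+
  \<comment> \<open>The exponent \<open>N + 2\<close> beats the time \<open>b / \<epsilon>\<^sup>N\<close> by a factor \<open>\<epsilon>\<^sup>2\<close>, negligible against \<open>I = O(\<epsilon>)\<close>.\<close>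
  define m where "m = N + 2"
  have "0 < 2 * m" by (simp add: m_def)
  then obtain c1 where c1: "0 \<le> c1" "\<And>x r. x \<in> tube M \<rho> \<Longrightarrow> 0 < r \<Longrightarrow> r \<le> 1 \<Longrightarrow> norm (z1 x) \<le> r \<Longrightarrow>
     \<bar>frechet_derivative I (at x) (X x)\<bar> \<le> c1 * r ^ (2 * m) \<and>
     \<bar>frechet_derivative g (at x) (X x)\<bar> \<le> c1 * r ^ (2 * m)"
    using X(2) unfolding adiabatic_on_def by metis
  define \<kappa> where "\<kappa> = 2 * c * a"
  have \<kappa>: "0 < \<kappa>" using c a by (simp add: \<kappa>_def)
  define c2 where "c2 = b * c1 * \<kappa> ^ m"
  have c2: "0 \<le> c2" using b c1 \<kappa> by (simp add: c2_def)
  have ev_pos: "\<forall>\<^sub>F \<epsilon> in at_right (0::real). 0 < \<epsilon>" by (rule eventually_at_right_less)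
  have ev1: "\<forall>\<^sub>F \<epsilon> in at_right 0. C0 + c * sqrt (a * \<epsilon>) + c2 * \<epsilon>\<^sup>2 + c * sqrt (c * (\<kappa> * \<epsilon>)) < C"
    by (rule order_tendstoD(2)[of _ "C0"]) (auto intro!: tendsto_eq_intros C0)
  have ev2: "\<forall>\<^sub>F \<epsilon> in at_right 0. \<kappa> * \<epsilon> < 1"
    by (rule order_tendstoD(2)[of _ 0]) (auto intro!: tendsto_eq_intros)
  have ev3: "\<forall>\<^sub>F \<epsilon> in at_right 0. (c * \<kappa> + a) * \<epsilon> < \<rho>\<^sup>2"
    by (rule order_tendstoD(2)[of _ 0]) (use \<rho> in \<open>auto intro!: tendsto_eq_intros\<close>)
  have ev4: "\<forall>\<^sub>F \<epsilon> in at_right 0. c2 * \<epsilon> < c * a"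
    by (rule order_tendstoD(2)[of _ 0]) (use c a in \<open>auto intro!: tendsto_eq_intros\<close>)
  show ?thesis
    using ev_pos ev1 ev2 ev3 ev4
  proof eventually_elim
    case (elim \<epsilon>)
    let ?D = "low_tube M \<rho> (\<kappa> * \<epsilon>)"
    let ?V = "{x \<in> U. norm (fst x) < M \<and> norm (snd x - A (fst x)) < \<rho> \<and> I x < \<kappa> * \<epsilon>}"
    have sqrtH: "sqrt (H x) = norm (snd x - A (fst x))" for x by (simp add: H_eq)
    have small: "norm (snd x - A (fst x)) < \<rho>" if "H x \<le> c * \<kappa> * \<epsilon> \<or> H x \<le> a * \<epsilon>" for x
    proof -
      have "0 \<le> c * \<kappa> * \<epsilon>" "0 \<le> a * \<epsilon>" using c \<kappa> a elim(1) by auto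
      then have "H x < \<rho>\<^sup>2" using elim(4) that by (auto simp: distrib_right)
      then show ?thesis using \<rho> by (simp add: H_eq power_less_imp_less_base)
    qed
    have inside: "norm (fst x) < M" if "mag_field A (fst x) < C" for x :: phase
      using that M[rule_format, of "fst x"] by (cases "M \<le> norm (fst x)") auto
    have "\<exists>\<gamma>. \<gamma> 0 = x \<and> integral_curve X ?D T \<gamma>"
      if B: "mag_field A (fst x) \<le> C0" and Hx: "H x \<le> a * \<epsilon>" and T: "0 \<le> T" "T \<le> b / \<epsilon> ^ N" for x T
    proof -
      have xM: "norm (fst x) < M" using inside B C0 by simp
      have x\<rho>: "norm (snd x - A (fst x)) < \<rho>" using small Hx by blast
      have xD: "x \<in> tube M \<rho>" using xM x\<rho> by (simp add: mem_tube)
      have Ix: "I x \<le> c * a * \<epsilon>"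
        using order_trans[OF c(2)[OF xD] mult_left_mono[OF Hx]] c(1) by (simp add: mult.assoc)
      have "0 < c * a * \<epsilon>" using c(1) a elim(1) by simp
      then have "I x < \<kappa> * \<epsilon>" using Ix by (simp add: \<kappa>_def)
      then have V: "?V \<subseteq> ?D" "x \<in> ?V"
        using xM x\<rho> xD D by (auto simp: low_tube_def mem_tube)
      have "\<exists>\<gamma>. \<gamma> 0 = x \<and> integral_curve X ?V T \<gamma>"
      proof (rule trapped_integral_curve_exists[OF X(1) open_U compact_low_tube[OF D] _ open_sublevel_tube V T(1)])
        show "?D \<subseteq> U" using D by (auto simp: low_tube_def)
        fix s \<gamma> assume s: "0 \<le> s" "s \<le> T" and \<gamma>0: "\<gamma> 0 = x" and \<gamma>: "integral_curve X ?D s \<gamma>"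
        define r where "r = sqrt (\<kappa> * \<epsilon>)"
        have r: "0 < r" "r \<le> 1" "r ^ (2 * m) = (\<kappa> * \<epsilon>) ^ m"
          using \<kappa> elim(1,3) by (auto simp: r_def power_mult)
        have drift: "\<bar>frechet_derivative I (at y) (X y)\<bar> \<le> c1 * r ^ (2 * m) \<and>
           \<bar>frechet_derivative g (at y) (X y)\<bar> \<le> c1 * r ^ (2 * m)" if "y \<in> ?D" for y
        proof (rule c1(2))
          have "(norm (z1 y))\<^sup>2 \<le> \<kappa> * \<epsilon>" using that by (simp add: low_tube_def I_def)
          then show "norm (z1 y) \<le> r" unfolding r_def by (rule real_le_rsqrt)
        qed (use that r in \<open>auto simp: low_tube_def\<close>)
        have diff: "I differentiable (at y)" "g differentiable (at y)" if "y \<in> ?D" for y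
        proof -
          have "y \<in> U" using that D by (auto simp: low_tube_def)
          then show "I differentiable (at y)" "g differentiable (at y)"
            using I_derivative g_derivative unfolding differentiable_def by blast+
        qed
        have "c1 * r ^ (2 * m) * s \<le> c1 * r ^ (2 * m) * (b / \<epsilon> ^ N)"
          using s T c1(1) r(1) by (intro mult_left_mono) auto
        also have "\<dots> = c1 * (\<kappa> * \<epsilon>) ^ m * (b / \<epsilon> ^ N)" by (simp only: r(3))
        also have "\<dots> = c2 * \<epsilon>\<^sup>2"
          using elim(1) by (simp add: c2_def m_def power_mult_distrib power_add power2_eq_square)
        finally have total: "c1 * r ^ (2 * m) * s \<le> c2 * \<epsilon>\<^sup>2" .
        have I_drift: "\<bar>I (\<gamma> s) - I x\<bar> \<le> c2 * \<epsilon>\<^sup>2"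
          using integral_curve_increment_bound[OF \<gamma> s(1), of I "c1 * r ^ (2 * m)"] drift diff total \<gamma>0 by force
        have g_drift: "\<bar>g (\<gamma> s) - g x\<bar> \<le> c2 * \<epsilon>\<^sup>2"
          using integral_curve_increment_bound[OF \<gamma> s(1), of g "c1 * r ^ (2 * m)"] drift diff total \<gamma>0 by force
        have \<gamma>s: "\<gamma> s \<in> tube M \<rho>" "I (\<gamma> s) \<le> \<kappa> * \<epsilon>"
          using \<gamma> s(1) by (auto simp: integral_curve_def low_tube_def)
        have "c2 * \<epsilon>\<^sup>2 < c * a * \<epsilon>"
          using mult_strict_right_mono[OF elim(5) elim(1)] by (simp add: power2_eq_square mult.assoc)
        then have I\<gamma>: "I (\<gamma> s) < \<kappa> * \<epsilon>"
          using I_drift Ix by (simp add: \<kappa>_def)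
        have H\<gamma>: "H (\<gamma> s) \<le> c * (\<kappa> * \<epsilon>)"
          using order_trans[OF c(3)[OF \<gamma>s(1)] mult_left_mono[OF \<gamma>s(2)]] c(1) by simp
        then have "c * sqrt (H (\<gamma> s)) \<le> c * sqrt (c * (\<kappa> * \<epsilon>))" using c(1) by simp
        moreover have "c * sqrt (H x) \<le> c * sqrt (a * \<epsilon>)" using Hx c(1) by simp
        ultimately have "mag_field A (fst (\<gamma> s)) < C"
          using pos[of "fst (\<gamma> s)"] pos[of "fst x"] c(4)[OF \<gamma>s(1)] c(4)[OF xD] g_drift B elim(2) by linarith
        then have "norm (fst (\<gamma> s)) < M" by (rule inside)
        moreover have "norm (snd (\<gamma> s) - A (fst (\<gamma> s))) < \<rho>" using small H\<gamma> by (simp add: mult.assoc)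
        ultimately show "\<gamma> s \<in> ?V" using I\<gamma> \<gamma>s(1) D by blast
      qed
      then show ?thesis using V(1) integral_curve_mono by blast
    qed
    then show ?case unfolding \<kappa>_def by blast
  qed
qed

section \<open>Comparison of the two flows over logarithmic times\<close>

text \<open>
  The fields differ by at most \<open>\<delta> = c (\<kappa> \<epsilon>)\<^bsup>k+n\<^esup>\<close> along the first curve, so Gronwall's inequality bounds
  \<open>|u - v|\<^sup>2\<close> by \<open>\<delta>\<^sup>2 exp ((2 L + 2) T)\<close>; the spare factor \<open>exp T\<close> dominates the factor \<open>T\<close>. As
  \<open>T \<le> b |ln \<epsilon>|\<close>, the exponential is at most \<open>\<epsilon>\<^sup>-\<^sup>n\<close>, which leaves \<open>\<epsilon>\<^bsup>2k+n\<^esup> \<le> \<epsilon>\<^bsup>2k\<^esup>\<close>.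
\<close>

lemma flows_comparison:
  assumes "0 \<le> T" "0 \<le> L" and \<sigma>: "\<bar>\<sigma>\<bar> = 1" and \<epsilon>: "0 < \<epsilon>" "\<epsilon> < 1" and \<kappa>: "0 < \<kappa>" "\<kappa> * \<epsilon> \<le> 1"
    and u: "integral_curve (\<lambda>x. \<sigma> *\<^sub>R ham_vf H x) (low_tube M \<rho> (\<kappa> * \<epsilon>)) T u"
    and v: "integral_curve (\<lambda>x. \<sigma> *\<^sub>R ham_vf K x) (low_tube M \<rho> (\<kappa> * \<epsilon>)) T v"
    and uv: "u 0 = v 0"
    and L: "L-lipschitz_on (tube M \<rho>) (ham_vf K)"
    and n: "(2 * L + 2) * b \<le> real n" and T: "T \<le> b * \<bar>ln \<epsilon>\<bar>"
    and c: "\<And>x r. x \<in> tube M \<rho> \<Longrightarrow> 0 < r \<Longrightarrow> r \<le> 1 \<Longrightarrow> norm (z1 x) \<le> r \<Longrightarrow>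
      norm (ham_vf H x - ham_vf K x) \<le> c * r ^ (2 * (k + n))"
    and "0 \<le> c"
  shows "norm (u T - v T) \<le> c * \<kappa> ^ (k + n) * \<epsilon> ^ k"
proof -
  define \<delta> where "\<delta> = c * (\<kappa> * \<epsilon>) ^ (k + n)"
  define r where "r = sqrt (\<kappa> * \<epsilon>)"
  have r: "0 < r" "r \<le> 1" "r ^ (2 * (k + n)) = (\<kappa> * \<epsilon>) ^ (k + n)"
    using \<kappa> \<epsilon> unfolding power_mult by (auto simp: r_def)
  have d: "norm (\<sigma> *\<^sub>R ham_vf H (u s) - \<sigma> *\<^sub>R ham_vf K (v s)) \<le> L * norm (u s - v s) + \<delta>"
    if s: "s \<in> {0..T}" for s
  proof -
    have mem: "u s \<in> tube M \<rho>" "v s \<in> tube M \<rho>" "I (u s) \<le> \<kappa> * \<epsilon>"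
      using u v s by (auto simp: integral_curve_def low_tube_def)
    have z1: "norm (z1 (u s)) \<le> r"
      using mem(3) unfolding r_def I_def by (rule real_le_rsqrt)
    have "norm (ham_vf H (u s) - ham_vf K (u s)) \<le> \<delta>"
      using c[OF mem(1) r(1,2) z1] unfolding r(3) \<delta>_def .
    moreover have "norm (ham_vf K (u s) - ham_vf K (v s)) \<le> L * norm (u s - v s)"
      by (rule lipschitz_on_normD[OF L mem(1,2)])
    moreover have "norm (ham_vf H (u s) - ham_vf K (v s)) \<le>
        norm (ham_vf H (u s) - ham_vf K (u s)) + norm (ham_vf K (u s) - ham_vf K (v s))"
      using norm_triangle_ineq[of "ham_vf H (u s) - ham_vf K (u s)" "ham_vf K (u s) - ham_vf K (v s)"] by simp
    ultimately have "norm (ham_vf H (u s) - ham_vf K (v s)) \<le> L * norm (u s - v s) + \<delta>" by linarith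
    then show ?thesis using \<sigma> by (simp flip: scaleR_diff_right)
  qed
  have "(norm (u T - v T))\<^sup>2 \<le> ((norm (u 0 - v 0))\<^sup>2 + \<delta>\<^sup>2 * T) * exp ((2 * L + 1) * T)"
    by (rule gronwall_comparison[OF \<open>0 \<le> T\<close> _ _ d \<open>0 \<le> L\<close>])
      (use u v in \<open>auto simp: integral_curve_def\<close>)
  also have "\<dots> \<le> (\<delta>\<^sup>2 * exp T) * exp ((2 * L + 1) * T)"
  proof -
    have "T \<le> exp T" using exp_ge_add_one_self[of T] by linarith
    then show ?thesis using uv by (auto intro!: mult_right_mono mult_left_mono)
  qed
  also have "\<dots> = \<delta>\<^sup>2 * exp ((2 * L + 2) * T)"
    by (simp add: mult.assoc algebra_simps flip: exp_add)
  also have "\<dots> \<le> \<delta>\<^sup>2 * exp (real n * \<bar>ln \<epsilon>\<bar>)"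
  proof -
    have "(2 * L + 2) * T \<le> (2 * L + 2) * (b * \<bar>ln \<epsilon>\<bar>)"
      using T \<open>0 \<le> L\<close> by (intro mult_left_mono) auto
    also have "\<dots> = ((2 * L + 2) * b) * \<bar>ln \<epsilon>\<bar>" by simp
    also have "\<dots> \<le> real n * \<bar>ln \<epsilon>\<bar>" by (intro mult_right_mono n) auto
    finally show ?thesis by (intro mult_left_mono) auto
  qed
  also have "exp (real n * \<bar>ln \<epsilon>\<bar>) = 1 / \<epsilon> ^ n"
  proof -
    have "exp (real n * \<bar>ln \<epsilon>\<bar>) = exp (\<bar>ln \<epsilon>\<bar>) ^ n" by (rule exp_of_nat_mult)
    also have "exp (\<bar>ln \<epsilon>\<bar>) = 1 / \<epsilon>" using \<epsilon> by (simp add: exp_minus field_simps)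
    finally show ?thesis by (simp add: power_one_over)
  qed
  also have "\<delta>\<^sup>2 * (1 / \<epsilon> ^ n) = (c * \<kappa> ^ (k + n) * \<epsilon> ^ k)\<^sup>2 * \<epsilon> ^ n"
    using \<epsilon> by (simp add: \<delta>_def power_mult_distrib power_add power2_eq_square)
  also have "\<dots> \<le> (c * \<kappa> ^ (k + n) * \<epsilon> ^ k)\<^sup>2 * 1"
    using \<epsilon> by (intro mult_left_mono power_le_one) auto
  finally have "(norm (u T - v T))\<^sup>2 \<le> (c * \<kappa> ^ (k + n) * \<epsilon> ^ k)\<^sup>2" by (simp only: mult_1_right)
  then show ?thesis
    by (rule power2_le_imp_le) (use \<kappa> \<epsilon> \<open>0 \<le> c\<close> in simp)
qed

end

theorem theorem1p2:
  fixes A :: "real^2 \<Rightarrow> real^2"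
    and C M C0 :: real
    and W :: "model set"
    and \<Phi> :: "model \<Rightarrow> phase"
    and f :: "(real^2) \<times> real \<Rightarrow> real"
  defines "H \<equiv> mag_ham A"
    and "B \<equiv> mag_field A"
    and "K \<equiv> nf_ham W \<Phi> f"
  assumes "smooth_on UNIV A"
    and "\<And>q. B q > 0"
    and "C > 0" and "M > 0"
    and "\<And>q. norm q \<ge> M \<Longrightarrow> B q \<ge> C"
    and "C0 < C"
    and "is_normal_form A W \<Phi> f"
  shows
    "(\<forall>(a::real) (b::real) (N::nat). \<exists>R. \<forall>\<^sub>F \<epsilon> in at_right (0::real).
        \<forall>q p t. B q \<le> C0 \<and> H (q, p) \<le> a * \<epsilon> \<and> \<bar>t\<bar> \<le> b / \<epsilon> ^ N \<longrightarrow>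
          ham_flow_defined UNIV H t (q, p) \<and> norm (ham_flow UNIV H t (q, p)) \<le> R)
     \<and>
     (\<forall>(a::real) (b::real) (k::nat). \<exists>c. \<forall>\<^sub>F \<epsilon> in at_right (0::real).
        \<forall>q p t. B q \<le> C0 \<and> H (q, p) \<le> a * \<epsilon> \<and> \<bar>t\<bar> \<le> b * \<bar>ln \<epsilon>\<bar> \<longrightarrow>
          ham_flow_defined UNIV H t (q, p) \<and> ham_flow_defined (\<Phi> ` W) K t (q, p) \<and>
          norm (ham_flow UNIV H t (q, p) - ham_flow (\<Phi> ` W) K t (q, p)) \<le> c * \<epsilon> ^ k)"
proof -
  interpret magnetic_normal_form A W \<Phi> f
    using assms(4,10) by unfold_locales
  obtain \<rho> where \<rho>: "0 < \<rho>" and D: "tube M \<rho> \<subseteq> \<Phi> ` W"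
    by (rule tube_in_U[OF \<open>M > 0\<close>])
  obtain c where c: "0 < c" "\<forall>x\<in>tube M \<rho>. I x \<le> c * mag_ham A x \<and> mag_ham A x \<le> c * I x \<and>
      \<bar>g x - \<bar>mag_field A (fst x)\<bar>\<bar> \<le> c * sqrt (mag_ham A x)"
    by (rule tube_estimates[OF \<rho> D])
  have M: "\<forall>q. M \<le> norm q \<longrightarrow> C \<le> mag_field A q" using assms(8) unfolding B_def by blast
  \<comment> \<open>Confinement on one energy scale, so that it can be used for both fields and both time
    directions at the same \<open>\<epsilon>\<close>.\<close>
  define trapped where "trapped X a b N \<epsilon> \<longleftrightarrow>
      (\<forall>x T. mag_field A (fst x) \<le> C0 \<and> mag_ham A x \<le> a * \<epsilon> \<and> 0 \<le> T \<and> T \<le> b / \<epsilon> ^ N \<longrightarrow>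
        (\<exists>\<gamma>. \<gamma> 0 = x \<and> integral_curve X (low_tube M \<rho> (2 * c * a * \<epsilon>)) T \<gamma>))"
    for X :: "phase \<Rightarrow> phase" and a b :: real and N :: nat and \<epsilon> :: real
  have trappedD: "\<exists>\<gamma>. \<gamma> 0 = x \<and> integral_curve X (low_tube M \<rho> (2 * c * a * \<epsilon>)) T \<gamma>"
    if "trapped X a b N \<epsilon>" "B (fst x) \<le> C0" "H x \<le> a * \<epsilon>" "0 \<le> T" "T \<le> b / \<epsilon> ^ N" for X a b N \<epsilon> x T
    using that unfolding trapped_def B_def H_def by blast
  note confine = confinement[OF assms(5)[unfolded B_def] M assms(9) \<rho> D c, folded trapped_def]
  note lip = lipschitz_on_compacts_scaleR[OF lipschitz_ham_vf_H] lipschitz_on_compacts_scaleR[OF lipschitz_ham_vf_K]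
  have trapped_H: "\<forall>\<^sub>F \<epsilon> in at_right 0. trapped (\<lambda>x. \<sigma> *\<^sub>R ham_vf (mag_ham A) x) a b N \<epsilon>"
    if "0 < a" "0 \<le> b" "\<bar>\<sigma>\<bar> = 1" for a b N \<sigma>
    by (rule confine[OF lipschitz_on_compacts_subset[OF lip(1) subset_UNIV]
          adiabatic_on_scaleR[OF adiabatic_on_H[OF compact_tube D] D that(3)] that(1,2)])
  have trapped_K: "\<forall>\<^sub>F \<epsilon> in at_right 0. trapped (\<lambda>x. \<sigma> *\<^sub>R ham_vf (nf_ham W \<Phi> f) x) a b N \<epsilon>"
    if "0 < a" "0 \<le> b" "\<bar>\<sigma>\<bar> = 1" for a b N \<sigma>
    by (rule confine[OF lip(2) adiabatic_on_scaleR[OF adiabatic_on_K[OF D] D that(3)] that(1,2)])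
  have sign: "\<exists>\<sigma> T. (\<sigma> = 1 \<or> \<sigma> = -1) \<and> 0 \<le> T \<and> T = \<bar>t\<bar> \<and> t = \<sigma> * T" for t :: real
    by (intro exI[of _ "if 0 \<le> t then 1 else -1"] exI[of _ "\<bar>t\<bar>"]) auto
  have low: "low_tube M \<rho> \<kappa> \<subseteq> tube M \<rho>" for \<kappa> by (auto simp: low_tube_def)
  have H_flow: "ham_flow_defined UNIV H (\<sigma> * T) x \<and> ham_flow UNIV H (\<sigma> * T) x = \<gamma> T"
    if "0 \<le> T" "\<sigma> = 1 \<or> \<sigma> = -1" "\<gamma> 0 = x" "integral_curve (\<lambda>x. \<sigma> *\<^sub>R ham_vf H x) Q T \<gamma>" for T \<sigma> \<gamma> x Q
    using ham_flow_eqI[OF that(1,2) lip(1)[folded H_def] integral_curve_mono[OF that(4) subset_UNIV] that(3)] by blast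
  have K_flow: "ham_flow_defined (\<Phi> ` W) K (\<sigma> * T) x \<and> ham_flow (\<Phi> ` W) K (\<sigma> * T) x = \<gamma> T"
    if "0 \<le> T" "\<sigma> = 1 \<or> \<sigma> = -1" "\<gamma> 0 = x" "integral_curve (\<lambda>x. \<sigma> *\<^sub>R ham_vf K x) Q T \<gamma>" "Q \<subseteq> \<Phi> ` W" for T \<sigma> \<gamma> x Q
    using ham_flow_eqI[OF that(1,2) lip(2)[folded K_def] integral_curve_mono[OF that(4,5)] that(3)] by blast
  \<comment> \<open>The constants \<open>a\<close> and \<open>b\<close> may be negative; they are replaced by \<open>max a 1\<close> and \<open>max b 0\<close>.\<close>
  have bounded_a: "H x \<le> max a 1 * \<epsilon>" if "H x \<le> a * \<epsilon>" "0 < \<epsilon>" for x a \<epsilon>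
    by (rule order_trans[OF that(1) mult_right_mono]) (use that(2) in auto)
  have part1: "\<exists>R. \<forall>\<^sub>F \<epsilon> in at_right 0. \<forall>q p t. B q \<le> C0 \<and> H (q, p) \<le> a * \<epsilon> \<and> \<bar>t\<bar> \<le> b / \<epsilon> ^ N \<longrightarrow>
          ham_flow_defined UNIV H t (q, p) \<and> norm (ham_flow UNIV H t (q, p)) \<le> R" for a b N
  proof -
    obtain R where R: "\<And>x. x \<in> tube M \<rho> \<Longrightarrow> norm x \<le> R"
      using compact_imp_bounded[OF compact_tube] unfolding bounded_iff by blast
    have a: "0 < max a 1" "0 \<le> max b 0" by auto
    have "\<forall>\<^sub>F \<epsilon> in at_right 0. 0 < \<epsilon> \<and> trapped (\<lambda>x. 1 *\<^sub>R ham_vf H x) (max a 1) (max b 0) N \<epsilon>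
        \<and> trapped (\<lambda>x. (-1) *\<^sub>R ham_vf H x) (max a 1) (max b 0) N \<epsilon>"
      by (intro eventually_conj eventually_at_right_less trapped_H[folded H_def] a) auto
    then have "\<forall>\<^sub>F \<epsilon> in at_right 0. \<forall>q p t. B q \<le> C0 \<and> H (q, p) \<le> a * \<epsilon> \<and> \<bar>t\<bar> \<le> b / \<epsilon> ^ N \<longrightarrow>
          ham_flow_defined UNIV H t (q, p) \<and> norm (ham_flow UNIV H t (q, p)) \<le> R"
    proof (rule eventually_mono, intro allI impI, elim conjE)
      fix \<epsilon> q p t
      assume \<epsilon>: "0 < \<epsilon>" and tr: "trapped (\<lambda>x. 1 *\<^sub>R ham_vf H x) (max a 1) (max b 0) N \<epsilon>"
         "trapped (\<lambda>x. (-1) *\<^sub>R ham_vf H x) (max a 1) (max b 0) N \<epsilon>"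
        and start: "B q \<le> C0" "H (q, p) \<le> a * \<epsilon>" and t: "\<bar>t\<bar> \<le> b / \<epsilon> ^ N"
      obtain \<sigma> T where \<sigma>: "\<sigma> = 1 \<or> \<sigma> = -1" "0 \<le> T" "T = \<bar>t\<bar>" "t = \<sigma> * T" using sign by blast
      have "b / \<epsilon> ^ N \<le> max b 0 / \<epsilon> ^ N" using \<epsilon> by (intro divide_right_mono) auto
      then have T: "T \<le> max b 0 / \<epsilon> ^ N" using t \<sigma>(3) by simp
      have tr': "trapped (\<lambda>x. \<sigma> *\<^sub>R ham_vf H x) (max a 1) (max b 0) N \<epsilon>" using tr \<sigma>(1) by blast
      obtain \<gamma> where \<gamma>: "\<gamma> 0 = (q, p)"
          "integral_curve (\<lambda>x. \<sigma> *\<^sub>R ham_vf H x) (low_tube M \<rho> (2 * c * max a 1 * \<epsilon>)) T \<gamma>"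
        using trappedD[OF tr' _ bounded_a[OF start(2) \<epsilon>] \<sigma>(2) T] start(1) by auto
      have "\<gamma> T \<in> tube M \<rho>" using \<gamma>(2) \<sigma>(2) by (auto simp: integral_curve_def low_tube_def)
      then show "ham_flow_defined UNIV H t (q, p) \<and> norm (ham_flow UNIV H t (q, p)) \<le> R"
        using H_flow[OF \<sigma>(2,1) \<gamma>] R \<sigma>(4) by simp
    qed
    then show ?thesis by blast
  qed
  have part2: "\<exists>c. \<forall>\<^sub>F \<epsilon> in at_right 0. \<forall>q p t. B q \<le> C0 \<and> H (q, p) \<le> a * \<epsilon> \<and> \<bar>t\<bar> \<le> b * \<bar>ln \<epsilon>\<bar> \<longrightarrow>
          ham_flow_defined UNIV H t (q, p) \<and> ham_flow_defined (\<Phi> ` W) K t (q, p) \<and>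
          norm (ham_flow UNIV H t (q, p) - ham_flow (\<Phi> ` W) K t (q, p)) \<le> c * \<epsilon> ^ k" for a b k
  proof -
    define a' b' where "a' = max a 1" and "b' = max b 0"
    have a: "0 < a'" "0 \<le> b'" by (auto simp: a'_def b'_def)
    define \<kappa> where "\<kappa> = 2 * c * a'"
    have \<kappa>: "0 < \<kappa>" using c(1) a by (simp add: \<kappa>_def)
    obtain L where L: "L-lipschitz_on (tube M \<rho>) (ham_vf K)"
      unfolding K_def by (rule lipschitz_on_compactsE[OF lipschitz_ham_vf_K compact_tube D])
    have L0: "0 \<le> L" by (rule lipschitz_on_nonneg[OF L])
    obtain n where n: "max 1 ((2 * L + 2) * b') \<le> real n" using real_arch_simple by blast
    have kn: "0 < 2 * (k + n)" using n by (cases n) auto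
    obtain c' where c': "0 \<le> c'" "\<forall>x\<in>tube M \<rho>. \<forall>r. 0 < r \<and> r \<le> 1 \<and> norm (z1 x) \<le> r \<longrightarrow>
      norm (ham_vf H x - ham_vf K x) \<le> c' * r ^ (2 * (k + n))"
      using ham_vf_diff_flat[OF compact_tube D kn] unfolding H_def K_def by blast
    have ev: "\<forall>\<^sub>F \<epsilon> in at_right 0. \<kappa> * \<epsilon> < 1" "\<forall>\<^sub>F \<epsilon> in at_right (0::real). \<epsilon> < 1"
      by (rule order_tendstoD(2)[of _ 0]; auto intro!: tendsto_eq_intros)+
    have "\<forall>\<^sub>F \<epsilon> in at_right 0. 0 < \<epsilon> \<and> \<epsilon> < 1 \<and> \<kappa> * \<epsilon> < 1
        \<and> trapped (\<lambda>x. 1 *\<^sub>R ham_vf H x) a' b' 1 \<epsilon> \<and> trapped (\<lambda>x. (-1) *\<^sub>R ham_vf H x) a' b' 1 \<epsilon>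
        \<and> trapped (\<lambda>x. 1 *\<^sub>R ham_vf K x) a' b' 1 \<epsilon> \<and> trapped (\<lambda>x. (-1) *\<^sub>R ham_vf K x) a' b' 1 \<epsilon>"
      by (intro eventually_conj eventually_at_right_less ev trapped_H[folded H_def] trapped_K[folded K_def] a) auto
    then have "\<forall>\<^sub>F \<epsilon> in at_right 0. \<forall>q p t. B q \<le> C0 \<and> H (q, p) \<le> a * \<epsilon> \<and> \<bar>t\<bar> \<le> b * \<bar>ln \<epsilon>\<bar> \<longrightarrow>
          ham_flow_defined UNIV H t (q, p) \<and> ham_flow_defined (\<Phi> ` W) K t (q, p) \<and>
          norm (ham_flow UNIV H t (q, p) - ham_flow (\<Phi> ` W) K t (q, p)) \<le> c' * \<kappa> ^ (k + n) * \<epsilon> ^ k"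
    proof (rule eventually_mono, intro allI impI, elim conjE)
      fix \<epsilon> q p t
      assume \<epsilon>: "0 < \<epsilon>" "\<epsilon> < 1" "\<kappa> * \<epsilon> < 1"
        and tr: "trapped (\<lambda>x. 1 *\<^sub>R ham_vf H x) a' b' 1 \<epsilon>" "trapped (\<lambda>x. (-1) *\<^sub>R ham_vf H x) a' b' 1 \<epsilon>"
          "trapped (\<lambda>x. 1 *\<^sub>R ham_vf K x) a' b' 1 \<epsilon>" "trapped (\<lambda>x. (-1) *\<^sub>R ham_vf K x) a' b' 1 \<epsilon>"
        and start: "B q \<le> C0" "H (q, p) \<le> a * \<epsilon>" and t: "\<bar>t\<bar> \<le> b * \<bar>ln \<epsilon>\<bar>"
      obtain \<sigma> T where \<sigma>: "\<sigma> = 1 \<or> \<sigma> = -1" "0 \<le> T" "T = \<bar>t\<bar>" "t = \<sigma> * T" using sign by blast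
      have \<sigma>1: "\<bar>\<sigma>\<bar> = 1" using \<sigma>(1) by auto
      have "b * \<bar>ln \<epsilon>\<bar> \<le> b' * \<bar>ln \<epsilon>\<bar>" by (intro mult_right_mono) (auto simp: b'_def)
      then have T: "T \<le> b' * \<bar>ln \<epsilon>\<bar>" using t \<sigma>(3) by simp
      \<comment> \<open>Logarithmic times are shorter than \<open>b' / \<epsilon>\<close>, so confinement with exponent \<open>1\<close> applies.\<close>
      have "\<bar>ln \<epsilon>\<bar> \<le> 1 / \<epsilon>"
        using \<epsilon> ln_le_minus_one[of "1 / \<epsilon>"] by (simp add: ln_div)
      then have "b' * \<bar>ln \<epsilon>\<bar> \<le> b' * (1 / \<epsilon>)" by (intro mult_left_mono a)
      then have T1: "T \<le> b' / \<epsilon> ^ 1" using T by simp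
      have tr': "trapped (\<lambda>x. \<sigma> *\<^sub>R ham_vf H x) a' b' 1 \<epsilon>" "trapped (\<lambda>x. \<sigma> *\<^sub>R ham_vf K x) a' b' 1 \<epsilon>"
        using tr \<sigma>(1) by blast+
      have start': "B (fst (q, p)) \<le> C0" "H (q, p) \<le> a' * \<epsilon>"
        using start(1) bounded_a[OF start(2) \<epsilon>(1)] by (simp_all add: a'_def)
      obtain u where u: "u 0 = (q, p)"
          "integral_curve (\<lambda>x. \<sigma> *\<^sub>R ham_vf H x) (low_tube M \<rho> (\<kappa> * \<epsilon>)) T u"
        using trappedD[OF tr'(1) start' \<sigma>(2) T1] unfolding \<kappa>_def by auto
      obtain v where v: "v 0 = (q, p)"
          "integral_curve (\<lambda>x. \<sigma> *\<^sub>R ham_vf K x) (low_tube M \<rho> (\<kappa> * \<epsilon>)) T v"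
        using trappedD[OF tr'(2) start' \<sigma>(2) T1] unfolding \<kappa>_def by auto
      have "norm (u T - v T) \<le> c' * \<kappa> ^ (k + n) * \<epsilon> ^ k"
        using u v n c'(2) \<epsilon>
        by (intro flows_comparison[OF \<sigma>(2) L0 \<sigma>1 \<epsilon>(1,2) \<kappa> _ u(2)[unfolded H_def] v(2)[unfolded K_def] _
              L[unfolded K_def] _ T _ c'(1)]) (auto simp: H_def K_def)
      then show "ham_flow_defined UNIV H t (q, p) \<and> ham_flow_defined (\<Phi> ` W) K t (q, p) \<and>
          norm (ham_flow UNIV H t (q, p) - ham_flow (\<Phi> ` W) K t (q, p)) \<le> c' * \<kappa> ^ (k + n) * \<epsilon> ^ k"
        using H_flow[OF \<sigma>(2,1) u] K_flow[OF \<sigma>(2,1) v subset_trans[OF low D]] \<sigma>(4) by simp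
    qed
    then show ?thesis by blast
  qed
  show ?thesis using part1 part2 by blast
qed

end
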